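(* Let $d,s\geq 3$ be fixed integers. If $d$ is odd and $ds + 2 > 2d + 2s$, then $\alpha_{d,s}(N)\leq N^{\frac{1}{2}+o(1)}$. If $d$ is even and $ds + 2 > 2d + 3s$, then $\alpha_{d,s}(N)\leq N^{\frac{1}{2}+o(1)}$. Here $o(1)$ denotes a quantity tending to $0$ as $N\to\infty$ with $d,s$ fixed.
   Context: A finite point set in $\mathbb{R}^d$ is in general position if no $d+1$ of its members lie on a common hyperplane. $\alpha_{d,s}(N)$ denotes the largest integer such that any set of $N$ points in $\mathbb{R}^d$, with no $d+s$ members on a common hyperplane, contains a subset of $\alpha_{d,s}(N)$ points in general position. *)

theory Defs
  imports "HOL-Analysis.Analysis"
begin

definition hyperplane :: "(real ^ 'd) set \<Rightarrow> bool" where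
  "hyperplane H \<longleftrightarrow> (\<exists>a b. a \<noteq> 0 \<and> H = {x. a \<bullet> x = b})"

definition no_members_on_hyperplane :: "nat \<Rightarrow> (real ^ 'd) set \<Rightarrow> bool" where
  "no_members_on_hyperplane k P \<longleftrightarrow>
     \<not> (\<exists>T H. T \<subseteq> P \<and> finite T \<and> card T = k \<and> hyperplane H \<and> T \<subseteq> H)"

definition general_position :: "(real ^ 'd) set \<Rightarrow> bool" where
  "general_position P \<longleftrightarrow> finite P \<and> no_members_on_hyperplane (CARD('d) + 1) P"

text \<open>
  The dimension is carried by the index type: \<open>alpha TYPE('d) s N\<close> is
  $\alpha_{d,s}(N)$ with $d$ the cardinality of \<open>'d\<close>.  For \<open>s \<ge> 1\<close> the maximum exists:
  \<open>m = 0\<close> qualifies, and \<open>m \<le> N\<close> because $N$-point sets in general position exist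
  (for instance on the moment curve).
\<close>
definition alpha :: "'d::finite itself \<Rightarrow> nat \<Rightarrow> nat \<Rightarrow> nat" where
  "alpha _ s N = (GREATEST m.
     \<forall>P :: (real ^ 'd) set.
       finite P \<and> card P = N \<and> no_members_on_hyperplane (CARD('d) + s) P \<longrightarrow>
       (\<exists>Q\<subseteq>P. card Q = m \<and> general_position Q))"

end

theory Submission
  imports Defs "HOL-Computational_Algebra.Polynomial" "HOL-Real_Asymp.Real_Asymp"
begin

text \<open>
  Put $h = \lfloor (d+1)/2 \rfloor$.  For either parity of $d$ the numerical hypothesis says exactly
  that $s(2h-1) > 2(d+s-1)$.  Suppose that a set in general position has more than $d$ points.  Then
  it contains no \<^emph>\<open>coincidence\<close>, that is, no $2h$ distinct points with
  $x_1+\dots+x_h = y_1+\dots+y_h$: such an equation is an affine dependence between at most $d+1$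
  points, and any $d+1$ points that contain a dependent set lie on a hyperplane
  (\<open>general_position_coincidence_free\<close>).  So it suffices to find $N$ points, no $d+s$ of them on a
  hyperplane, such that every subset of size about $\sqrt N$ contains a coincidence.

  The points are a random subset of a generic linear image $G$ in $\mathbb{R}^d$ of the grid
  $\{0,\dots,n-1\}^D$ (\<open>projected_grid_exists\<close>).  Put $M = n^D$, the size of $G$.  Sums of $h$ elements of
  $G$ take at most $K = h^D M$ values, so coincidences abound.  On the other hand genericity leaves
  at most $n^{d-1}$ points of $G$ on any hyperplane, a power of $M$ whose exponent is as small as one
  likes once $D$ is large.  Hence $G$ has at most $M^d n^{(d-1)s}$ coplanar $(d+s)$-tuples, and a random
  subset with $2N$ elements, where $N$ is slightly below $M^{s/(d+s-1)}$, is expected to contain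
  fewer than $N$ of them; removing one point from each leaves $N$ points
  (\<open>subset_avoiding_families\<close>).

  It remains to count the coincidence-free subsets of $G$ of size $m = N^{1/2+\delta}$.  By Cauchy--Schwarz
  a subset $V$ of $G$ with $|V|^2 \gg K$ contains at least a constant times $|V|^{2h}/K$ coincidences, and few of them
  share a prescribed set of points.  A container lemma for hypergraphs (\<open>containers\<close>) then
  covers all coincidence-free subsets of $V$ by $|V|^{O(b)}$ sets that are smaller than $V$ by a constant
  factor, provided that $K \le b |V|$ and $K \le b^{2h-1}$.  Iterating $R = O(\log M)$ times brings the
  containers down to size $C = Mm/(48N)$ (\<open>coincidence_containers\<close>).  With $b \approx \sqrt N$ the first
  condition holds because $b m \gg N$, and the second one is $N^{(2h-1)/2} \gg M \approx N^{(d+s-1)/s}$, which is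
  the numerical hypothesis.  There are $M^{O(bR)} \le 2^m$ containers, so the expected number of
  coincidence-free $m$-sets in the random subset is at most
  $2^m (3C/m)^m (2N/M)^m = 4^{-m} < 1$.
\<close>

section \<open>Containers for weighted hypergraphs\<close>

text \<open>
  Hypergraphs are edge weights rather than sets of edges, because one and the same set can arise
  several times as a link in the construction below and must then count with multiplicity.  The
  total weight is \<open>wdeg V w {}\<close>.
\<close>

definition wdeg :: "'a set \<Rightarrow> ('a set \<Rightarrow> real) \<Rightarrow> 'a set \<Rightarrow> real" where
  "wdeg V w T = (\<Sum>f | T \<subseteq> f \<and> f \<subseteq> V. w f)"

definition uniform_weight :: "nat \<Rightarrow> ('a set \<Rightarrow> real) \<Rightarrow> bool" where
  "uniform_weight l w \<longleftrightarrow> (\<forall>f. 0 \<le> w f \<and> (w f \<noteq> 0 \<longrightarrow> card f = l))"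

definition avoids :: "'a set \<Rightarrow> ('a set \<Rightarrow> real) \<Rightarrow> bool" where
  "avoids I w \<longleftrightarrow> (\<forall>f\<subseteq>I. w f = 0)"

text \<open>
  No set of \<open>j\<close> vertices carries much more weight than $t^{j-1}$ times the average weight at a
  vertex.  This is the usual bound on maximum codegrees in the container method.
\<close>

definition spread :: "'a set \<Rightarrow> real \<Rightarrow> real \<Rightarrow> ('a set \<Rightarrow> real) \<Rightarrow> bool" where
  "spread V t B w \<longleftrightarrow>
     (\<forall>T\<subseteq>V. T \<noteq> {} \<longrightarrow> wdeg V w T \<le> B * (wdeg V w {} / real (card V)) * t ^ (card T - 1))"

text \<open>
  The function \<open>c\<close> caps degrees: a set \<open>T\<close> is saturated once its degree reaches \<open>c (card T)\<close>.
\<close>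

definition unsaturated :: "'a set \<Rightarrow> (nat \<Rightarrow> real) \<Rightarrow> ('a set \<Rightarrow> real) \<Rightarrow> 'a set \<Rightarrow> bool" where
  "unsaturated V c w f \<longleftrightarrow> (\<forall>T\<subseteq>f. T \<noteq> {} \<longrightarrow> wdeg V w T < c (card T))"

text \<open>
  The edges \<open>f\<close> with \<open>insert x f\<close> an edge of \<open>w\<close> form the link of \<open>x\<close>.  The links of the vertices of
  the list (the latest vertex stands in front) are accumulated, except that no edge is added any more that contains a saturated
  set.  This keeps the codegrees of the \<open>l\<close>-uniform result bounded.
\<close>

fun links :: "'a set \<Rightarrow> (nat \<Rightarrow> real) \<Rightarrow> ('a set \<Rightarrow> real) \<Rightarrow> 'a list \<Rightarrow> 'a set \<Rightarrow> real" where
  "links V c w [] = (\<lambda>f. 0)"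
| "links V c w (x # xs) = (\<lambda>f. links V c w xs f +
     (if x \<notin> f \<and> unsaturated V c (links V c w xs) f then w (insert x f) else 0))"

text \<open>
  The weight by which the total of \<open>w'\<close> would grow if the link of \<open>u\<close> were added to it.
\<close>

definition gain :: "'a set \<Rightarrow> (nat \<Rightarrow> real) \<Rightarrow> ('a set \<Rightarrow> real) \<Rightarrow> ('a set \<Rightarrow> real) \<Rightarrow> 'a \<Rightarrow> real" where
  "gain V c w w' u = (\<Sum>f | f \<subseteq> V \<and> u \<notin> f \<and> unsaturated V c w' f. w (insert u f))"

lemma wdeg_nonneg: "uniform_weight l w \<Longrightarrow> 0 \<le> wdeg V w T"
  by (auto simp: wdeg_def uniform_weight_def intro!: sum_nonneg)

lemma wdeg_mono:
  assumes "\<And>f. w f \<le> w' f"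
  shows "wdeg V w T \<le> wdeg V w' T"
  unfolding wdeg_def by (intro sum_mono assms)

lemma sum_insert_eq_wdeg:
  assumes "x \<in> V" "x \<notin> T"
  shows "(\<Sum>f | T \<subseteq> f \<and> f \<subseteq> V \<and> x \<notin> f. w (insert x f)) = wdeg V w (insert x T)"
  unfolding wdeg_def
  by (rule sum.reindex_bij_witness[of _ "\<lambda>g. g - {x}" "insert x"]) (use assms in auto)

lemma sum_wdeg_insert:
  assumes "finite V"
  shows "(\<Sum>u\<in>V - T. wdeg V w (insert u T)) = (\<Sum>g | T \<subseteq> g \<and> g \<subseteq> V. real (card (g - T)) * w g)"
proof -
  have fin: "finite {g. T \<subseteq> g \<and> g \<subseteq> V}"
    using assms by (auto intro: finite_subset[of _ "Pow V"])
  have "(\<Sum>u\<in>V - T. wdeg V w (insert u T))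
      = (\<Sum>u\<in>V - T. \<Sum>g | g \<in> {g. T \<subseteq> g \<and> g \<subseteq> V} \<and> u \<in> g. w g)"
    unfolding wdeg_def by (intro sum.cong refl) auto
  also have "\<dots> = (\<Sum>g\<in>{g. T \<subseteq> g \<and> g \<subseteq> V}. \<Sum>u | u \<in> V - T \<and> u \<in> g. w g)"
    by (rule sum.swap_restrict) (use assms fin in auto)
  also have "\<dots> = (\<Sum>g | T \<subseteq> g \<and> g \<subseteq> V. real (card (g - T)) * w g)"
  proof (rule sum.cong[OF refl])
    fix g assume "g \<in> {g. T \<subseteq> g \<and> g \<subseteq> V}"
    then have "{u. u \<in> V - T \<and> u \<in> g} = g - T" by auto
    then show "(\<Sum>u | u \<in> V - T \<and> u \<in> g. w g) = real (card (g - T)) * w g" by simp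
  qed
  finally show ?thesis .
qed

lemma sum_wdeg_all:
  assumes "finite V" "uniform_weight l w"
  shows "(\<Sum>T\<in>Pow V. wdeg V w T) = 2 ^ l * wdeg V w {}"
proof -
  have "(\<Sum>T\<in>Pow V. wdeg V w T) = (\<Sum>T\<in>Pow V. \<Sum>g | g \<in> Pow V \<and> T \<subseteq> g. w g)"
    unfolding wdeg_def by (intro sum.cong refl) auto
  also have "\<dots> = (\<Sum>g\<in>Pow V. \<Sum>T | T \<in> Pow V \<and> T \<subseteq> g. w g)"
    by (rule sum.swap_restrict) (use assms in auto)
  also have "\<dots> = (\<Sum>g\<in>Pow V. 2 ^ l * w g)"
  proof (rule sum.cong[OF refl])
    fix g assume g: "g \<in> Pow V"
    then have "{T. T \<in> Pow V \<and> T \<subseteq> g} = Pow g" by auto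
    moreover have "finite g" using g assms by (auto intro: finite_subset)
    moreover have "w g \<noteq> 0 \<Longrightarrow> card g = l" using assms by (simp add: uniform_weight_def)
    ultimately show "(\<Sum>T | T \<in> Pow V \<and> T \<subseteq> g. w g) = 2 ^ l * w g"
      by (cases "w g = 0") (auto simp: card_Pow)
  qed
  also have "\<dots> = 2 ^ l * wdeg V w {}"
    by (simp add: wdeg_def sum_distrib_left Pow_def)
  finally show ?thesis .
qed

lemma links_uniform:
  assumes "uniform_weight (Suc l) w"
  shows "uniform_weight l (links V c w xs)"
proof (induction xs)
  case Nil
  then show ?case by (simp add: uniform_weight_def)
next
  case (Cons x xs)
  have "card f = l" if "x \<notin> f" "w (insert x f) \<noteq> 0" for f
  proof -
    have "card (insert x f) = Suc l" using that assms by (simp add: uniform_weight_def)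
    moreover from this have "finite f" by (metis card.infinite finite_insert nat.distinct(1))
    ultimately show ?thesis using that by simp
  qed
  moreover have "0 \<le> w g" for g using assms by (simp add: uniform_weight_def)
  moreover have "0 \<le> links V c w xs g" "links V c w xs g \<noteq> 0 \<Longrightarrow> card g = l" for g
    using Cons by (auto simp: uniform_weight_def)
  ultimately show ?case
    unfolding uniform_weight_def by (fastforce split: if_splits intro!: add_nonneg_nonneg)
qed

text \<open>
  This is what links are for: if \<open>insert x f\<close> is not contained in \<open>I\<close> although \<open>x\<close> is an element of \<open>I\<close>, then \<open>f\<close> is not
  contained in \<open>I\<close>.  So choosing vertices from \<open>I\<close> lowers the uniformity and keeps \<open>I\<close> independent.
\<close>

lemma links_avoids:
  assumes "avoids I w" "set xs \<subseteq> I"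
  shows "avoids I (links V c w xs)"
  using assms(2)
proof (induction xs)
  case (Cons x xs)
  then show ?case using assms(1) by (auto simp: avoids_def)
qed (simp add: avoids_def)

lemma wdeg_links_Cons:
  assumes "finite V"
  shows "wdeg V (links V c w (x # xs)) T = wdeg V (links V c w xs) T +
    (\<Sum>f | T \<subseteq> f \<and> f \<subseteq> V \<and> x \<notin> f \<and> unsaturated V c (links V c w xs) f. w (insert x f))"
proof -
  have fin: "finite {f. T \<subseteq> f \<and> f \<subseteq> V}"
    using assms by (auto intro: finite_subset[of _ "Pow V"])
  have "{f. T \<subseteq> f \<and> f \<subseteq> V} \<inter> {f. x \<notin> f \<and> unsaturated V c (links V c w xs) f}
      = {f. T \<subseteq> f \<and> f \<subseteq> V \<and> x \<notin> f \<and> unsaturated V c (links V c w xs) f}" by auto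
  then show ?thesis
    using fin by (simp add: wdeg_def sum.distrib sum.If_cases)
qed

lemma gain_links_antimono:
  assumes "finite V" "uniform_weight l w"
  shows "gain V c w (links V c w (x # xs)) u \<le> gain V c w (links V c w xs) u"
  unfolding gain_def
proof (rule sum_mono2)
  show "finite {f. f \<subseteq> V \<and> u \<notin> f \<and> unsaturated V c (links V c w xs) f}"
    using assms by (auto intro: finite_subset[of _ "Pow V"])
  have "wdeg V (links V c w xs) T \<le> wdeg V (links V c w (x # xs)) T" for T
    by (rule wdeg_mono) (use assms in \<open>auto simp: uniform_weight_def\<close>)
  then show "{f. f \<subseteq> V \<and> u \<notin> f \<and> unsaturated V c (links V c w (x # xs)) f}
      \<subseteq> {f. f \<subseteq> V \<and> u \<notin> f \<and> unsaturated V c (links V c w xs) f}"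
    unfolding unsaturated_def by (blast intro: le_less_trans)
qed (use assms in \<open>auto simp: uniform_weight_def\<close>)

text \<open>
  Always choose the vertex of \<open>I\<close> with the largest gain.  Gains only decrease in the
  process, so at the end no vertex of \<open>I\<close> has a gain above the average over the \<open>k\<close> steps.  Hence either the
  links have large total weight, or all of \<open>I\<close> lies in the set of vertices of small gain, and this set is
  determined by the chosen list.
\<close>

lemma greedy_links:
  assumes "finite V" "uniform_weight l w" "finite I" "I \<noteq> {}"
  shows "\<exists>xs. set xs \<subseteq> I \<and> length xs = k \<and>
    (\<forall>u\<in>I. real k * gain V c w (links V c w xs) u \<le> wdeg V (links V c w xs) {})"
proof (induction k)
  case 0
  then show ?case by (intro exI[of _ "[]"]) (simp add: wdeg_def)
next
  case (Suc k)
  then obtain xs where xs: "set xs \<subseteq> I" "length xs = k"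
    "\<And>u. u \<in> I \<Longrightarrow> real k * gain V c w (links V c w xs) u \<le> wdeg V (links V c w xs) {}" by blast
  define g where "g = gain V c w (links V c w xs)"
  obtain x where x: "x \<in> I" "\<And>u. u \<in> I \<Longrightarrow> g u \<le> g x"
  proof -
    have "Max (g ` I) \<in> g ` I" using assms by (intro Max_in) auto
    then obtain x where "x \<in> I" "g x = Max (g ` I)" by auto
    then show ?thesis using that[of x] assms by simp
  qed
  have tot: "wdeg V (links V c w (x # xs)) {} = wdeg V (links V c w xs) {} + g x"
    by (subst wdeg_links_Cons) (use assms in \<open>auto simp: g_def gain_def\<close>)
  have "real (Suc k) * gain V c w (links V c w (x # xs)) u \<le> wdeg V (links V c w (x # xs)) {}"
    if "u \<in> I" for u
  proof -
    have a: "gain V c w (links V c w (x # xs)) u \<le> g u"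
      unfolding g_def by (rule gain_links_antimono[OF assms(1,2)])
    have "real (Suc k) * gain V c w (links V c w (x # xs)) u \<le> real (Suc k) * g u"
      using a by (intro mult_left_mono) auto
    also have "\<dots> = real k * g u + g u" by (simp add: algebra_simps)
    also have "\<dots> \<le> wdeg V (links V c w xs) {} + g x"
      using xs(3)[OF that] x(2)[OF that] unfolding g_def by linarith
    finally show ?thesis using tot by simp
  qed
  then show ?case using xs x by (intro exI[of _ "x # xs"]) auto
qed

text \<open>
  The degree of \<open>T\<close> grows only while it is below the cap, and adding the link of \<open>x\<close> to it adds at
  most the degree of \<open>insert x T\<close>.
\<close>

lemma wdeg_links_le:
  assumes V: "finite V" and w: "uniform_weight l w" and xs: "set xs \<subseteq> V"
    and T: "T \<noteq> {}" and c: "0 \<le> c (card T)" and D: "0 \<le> D"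
    and bd: "\<And>x. x \<in> V - T \<Longrightarrow> wdeg V w (insert x T) \<le> D"
  shows "wdeg V (links V c w xs) T \<le> c (card T) + D"
  using xs
proof (induction xs)
  case Nil
  then show ?case using c D by (simp add: wdeg_def)
next
  case (Cons x xs)
  define S where "S = (\<Sum>f | T \<subseteq> f \<and> f \<subseteq> V \<and> x \<notin> f \<and> unsaturated V c (links V c w xs) f. w (insert x f))"
  have eq: "wdeg V (links V c w (x # xs)) T = wdeg V (links V c w xs) T + S"
    unfolding S_def by (rule wdeg_links_Cons[OF V])
  show ?case
  proof (cases "wdeg V (links V c w xs) T < c (card T) \<and> x \<notin> T")
    case False
    then have "{f. T \<subseteq> f \<and> f \<subseteq> V \<and> x \<notin> f \<and> unsaturated V c (links V c w xs) f} = {}"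
      using T unfolding unsaturated_def by blast
    then have "S = 0" unfolding S_def by (simp only: sum.empty)
    then show ?thesis using eq Cons by simp
  next
    case True
    have "S \<le> (\<Sum>f | T \<subseteq> f \<and> f \<subseteq> V \<and> x \<notin> f. w (insert x f))"
      unfolding S_def
    proof (rule sum_mono2)
      show "finite {f. T \<subseteq> f \<and> f \<subseteq> V \<and> x \<notin> f}"
        using V by (auto intro: finite_subset[of _ "Pow V"])
    qed (use w in \<open>auto simp: uniform_weight_def\<close>)
    also have "\<dots> = wdeg V w (insert x T)"
      using True Cons.prems by (intro sum_insert_eq_wdeg) auto
    also have "\<dots> \<le> D" using True Cons.prems by (intro bd) auto
    finally show ?thesis using True eq by linarith
  qed
qed

text \<open>
  Without saturation the gains would add up to \<open>Suc l\<close> times the total weight of \<open>w\<close>.  What is lost is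
  the weight of the edges that contain a saturated set.  Saturated sets have degree at least \<open>c\<close> in
  \<open>w'\<close>, so there are few of them if \<open>w'\<close> has small total weight, and by \<open>bd\<close> each of them has a degree of
  at most \<open>a * c\<close> in \<open>w\<close>.
\<close>

lemma sum_gain_ge:
  assumes V: "finite V" and w: "uniform_weight (Suc l) w" and w': "uniform_weight l w'"
    and c: "\<And>j. 0 < j \<Longrightarrow> 0 < c j" and a: "0 \<le> a"
    and bd: "\<And>T. T \<subseteq> V \<Longrightarrow> T \<noteq> {} \<Longrightarrow> wdeg V w T \<le> a * c (card T)"
  shows "real (Suc l) * (wdeg V w {} - a * 2 ^ l * wdeg V w' {}) \<le> (\<Sum>u\<in>V. gain V c w w' u)"
proof -
  define Sat where "Sat = {T. T \<subseteq> V \<and> T \<noteq> {} \<and> c (card T) \<le> wdeg V w' T}"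
  have wnn: "0 \<le> w f" "0 \<le> w' f" for f using w w' by (auto simp: uniform_weight_def)
  have fS: "finite Sat" unfolding Sat_def using V by (auto intro: finite_subset[of _ "Pow V"])
  have fin: "finite {f. f \<subseteq> V \<and> P f}" for P
    using V by (auto intro: finite_subset[of _ "Pow V"])
  have card_le: "real (card (g - T)) * w g \<le> real (Suc l) * w g" if "g \<subseteq> V" for g T
  proof (cases "w g = 0")
    case False
    then have "card g = Suc l" using w by (simp add: uniform_weight_def)
    moreover have "card (g - T) \<le> card g"
      using that V by (intro card_mono) (auto intro: finite_subset)
    ultimately show ?thesis using wnn by (intro mult_right_mono) auto
  qed simp
  have one: "wdeg V w {u} - (\<Sum>T | T \<in> Sat \<and> u \<notin> T. wdeg V w (insert u T)) \<le> gain V c w w' u"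
    if u: "u \<in> V" for u
  proof -
    let ?F = "{f. f \<subseteq> V \<and> u \<notin> f \<and> unsaturated V c w' f}"
    let ?F' = "{f. f \<subseteq> V \<and> u \<notin> f \<and> \<not> unsaturated V c w' f}"
    have "wdeg V w {u} = (\<Sum>f | f \<subseteq> V \<and> u \<notin> f. w (insert u f))"
      using sum_insert_eq_wdeg[of u V "{}" w] u by simp
    also have "{f. f \<subseteq> V \<and> u \<notin> f} = ?F \<union> ?F'" by auto
    also have "(\<Sum>f\<in>?F \<union> ?F'. w (insert u f)) = gain V c w w' u + (\<Sum>f\<in>?F'. w (insert u f))"
      unfolding gain_def by (rule sum.union_disjoint) (use fin in auto)
    finally have e: "wdeg V w {u} = gain V c w w' u + (\<Sum>f\<in>?F'. w (insert u f))" .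
    have "(\<Sum>f\<in>?F'. w (insert u f)) \<le> (\<Sum>f\<in>?F'. \<Sum>T | T \<in> Sat \<and> T \<subseteq> f. w (insert u f))"
    proof (rule sum_mono)
      fix f assume f: "f \<in> ?F'"
      then obtain T where T: "T \<subseteq> f" "T \<noteq> {}" "c (card T) \<le> wdeg V w' T"
        by (auto simp: unsaturated_def not_less)
      then have "T \<in> {T. T \<in> Sat \<and> T \<subseteq> f}" using f by (auto simp: Sat_def)
      moreover have "finite {T. T \<in> Sat \<and> T \<subseteq> f}" using fS by simp
      ultimately show "w (insert u f) \<le> (\<Sum>T | T \<in> Sat \<and> T \<subseteq> f. w (insert u f))"
        using wnn by (intro member_le_sum) auto
    qed
    also have "\<dots> = (\<Sum>T\<in>Sat. \<Sum>f | f \<in> ?F' \<and> T \<subseteq> f. w (insert u f))"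
      by (rule sum.swap_restrict) (use fS fin in auto)
    also have "\<dots> \<le> (\<Sum>T\<in>Sat. if u \<notin> T then wdeg V w (insert u T) else 0)"
    proof (rule sum_mono)
      fix T assume T: "T \<in> Sat"
      show "(\<Sum>f | f \<in> ?F' \<and> T \<subseteq> f. w (insert u f)) \<le> (if u \<notin> T then wdeg V w (insert u T) else 0)"
      proof (cases "u \<in> T")
        case True
        then have "{f. f \<in> ?F' \<and> T \<subseteq> f} = {}" by auto
        then show ?thesis using True by (simp only: sum.empty) simp
      next
        case False
        have "(\<Sum>f | f \<in> ?F' \<and> T \<subseteq> f. w (insert u f)) \<le> (\<Sum>f | T \<subseteq> f \<and> f \<subseteq> V \<and> u \<notin> f. w (insert u f))"
        proof (rule sum_mono2)
          show "finite {f. T \<subseteq> f \<and> f \<subseteq> V \<and> u \<notin> f}"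
            using V by (auto intro: finite_subset[of _ "Pow V"])
        qed (use wnn in auto)
        also have "\<dots> = wdeg V w (insert u T)"
          using False u by (intro sum_insert_eq_wdeg)
        finally show ?thesis using False by simp
      qed
    qed
    also have "\<dots> = (\<Sum>T | T \<in> Sat \<and> u \<notin> T. wdeg V w (insert u T))"
      using fS by (simp add: sum.inter_filter)
    finally show ?thesis using e by linarith
  qed
  have "(\<Sum>u\<in>V. wdeg V w {u}) = (\<Sum>g | g \<subseteq> V. real (card g) * w g)"
    using sum_wdeg_insert[OF V, where T="{}" and w=w] by simp
  also have "\<dots> = (\<Sum>g | g \<subseteq> V. real (Suc l) * w g)"
  proof (rule sum.cong[OF refl])
    fix g
    have "w g \<noteq> 0 \<Longrightarrow> card g = Suc l" using w by (simp add: uniform_weight_def)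
    then show "real (card g) * w g = real (Suc l) * w g" by (cases "w g = 0") auto
  qed
  also have "\<dots> = real (Suc l) * wdeg V w {}"
    by (simp add: wdeg_def sum_distrib_left)
  finally have tot: "(\<Sum>u\<in>V. wdeg V w {u}) = real (Suc l) * wdeg V w {}" .
  have "(\<Sum>u\<in>V. \<Sum>T | T \<in> Sat \<and> u \<notin> T. wdeg V w (insert u T))
      = (\<Sum>T\<in>Sat. \<Sum>u | u \<in> V \<and> u \<notin> T. wdeg V w (insert u T))"
    by (rule sum.swap_restrict) (use V fS in auto)
  also have "\<dots> \<le> (\<Sum>T\<in>Sat. real (Suc l) * a * wdeg V w' T)"
  proof (rule sum_mono)
    fix T assume T: "T \<in> Sat"
    then have TV: "T \<subseteq> V" "T \<noteq> {}" "c (card T) \<le> wdeg V w' T" by (auto simp: Sat_def)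
    have "{u. u \<in> V \<and> u \<notin> T} = V - T" by auto
    then have "(\<Sum>u | u \<in> V \<and> u \<notin> T. wdeg V w (insert u T))
        = (\<Sum>g | T \<subseteq> g \<and> g \<subseteq> V. real (card (g - T)) * w g)"
      using sum_wdeg_insert[OF V, where T=T and w=w] by simp
    also have "\<dots> \<le> (\<Sum>g | T \<subseteq> g \<and> g \<subseteq> V. real (Suc l) * w g)"
      by (intro sum_mono card_le) auto
    also have "\<dots> = real (Suc l) * wdeg V w T" by (simp add: wdeg_def sum_distrib_left)
    also have "\<dots> \<le> real (Suc l) * (a * c (card T))"
      using bd TV by (intro mult_left_mono) auto
    also have "\<dots> \<le> real (Suc l) * (a * wdeg V w' T)"
      using TV a by (intro mult_left_mono) auto
    finally show "(\<Sum>u | u \<in> V \<and> u \<notin> T. wdeg V w (insert u T)) \<le> real (Suc l) * a * wdeg V w' T"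
      by (simp add: mult.assoc)
  qed
  also have "\<dots> \<le> (\<Sum>T\<in>Pow V. real (Suc l) * a * wdeg V w' T)"
    using V a wdeg_nonneg[OF w'] by (intro sum_mono2) (auto simp: Sat_def)
  also have "\<dots> = real (Suc l) * a * (2 ^ l * wdeg V w' {})"
    by (simp add: sum_wdeg_all[OF V w', symmetric] sum_distrib_left)
  finally have lost: "(\<Sum>u\<in>V. \<Sum>T | T \<in> Sat \<and> u \<notin> T. wdeg V w (insert u T))
      \<le> real (Suc l) * a * (2 ^ l * wdeg V w' {})" .
  have "(\<Sum>u\<in>V. wdeg V w {u} - (\<Sum>T | T \<in> Sat \<and> u \<notin> T. wdeg V w (insert u T)))
      \<le> (\<Sum>u\<in>V. gain V c w w' u)"
    by (intro sum_mono one)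
  then show ?thesis
    using tot lost by (simp add: sum_subtractf algebra_simps)
qed

text \<open>
  For a hypergraph whose edges are single vertices, an independent set misses the support of
  \<open>w\<close>.  No vertex carries more than \<open>B\<close> times the average, so the support has at least \<open>card V / B\<close>
  elements.
\<close>

lemma containers_singletons:
  assumes V: "finite V" "V \<noteq> {}" and w: "uniform_weight 1 w" and B: "0 < B"
    and W: "0 < wdeg V w {}" and sp: "spread V t B w"
  shows "real (card {v\<in>V. w {v} = 0}) \<le> (1 - 1 / B) * real (card V)"
proof -
  define W where "W = wdeg V w {}"
  have single: "wdeg V w {v} = w {v}" if "v \<in> V" for v
  proof -
    have "wdeg V w {v} = (\<Sum>f\<in>{{v}}. w f)"
      unfolding wdeg_def
    proof (rule sum.mono_neutral_right)
      show "\<forall>i\<in>{f. {v} \<subseteq> f \<and> f \<subseteq> V} - {{v}}. w i = 0"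
      proof
        fix f assume f: "f \<in> {f. {v} \<subseteq> f \<and> f \<subseteq> V} - {{v}}"
        then have "card f \<noteq> 1" by (auto simp: card_1_singleton_iff)
        then show "w f = 0" using w by (auto simp: uniform_weight_def)
      qed
    qed (use V that in \<open>auto intro: finite_subset[of _ "Pow V"]\<close>)
    then show ?thesis by simp
  qed
  have "W = (\<Sum>v\<in>V. wdeg V w {v})"
  proof -
    have "(\<Sum>v\<in>V. wdeg V w {v}) = (\<Sum>g | g \<subseteq> V. real (card g) * w g)"
      using sum_wdeg_insert[OF V(1), where T="{}" and w=w] by simp
    also have "\<dots> = (\<Sum>g | g \<subseteq> V. w g)"
    proof (rule sum.cong[OF refl])
      fix g
      have "w g \<noteq> 0 \<Longrightarrow> card g = 1" using w by (simp add: uniform_weight_def)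
      then show "real (card g) * w g = w g" by (cases "w g = 0") auto
    qed
    finally show ?thesis by (simp add: W_def wdeg_def)
  qed
  also have "\<dots> = (\<Sum>v\<in>V. w {v})" by (intro sum.cong refl single)
  also have "\<dots> = (\<Sum>v\<in>{v\<in>V. w {v} \<noteq> 0}. w {v})"
    using V by (intro sum.mono_neutral_right) auto
  also have "\<dots> \<le> (\<Sum>v\<in>{v\<in>V. w {v} \<noteq> 0}. B * (W / real (card V)))"
  proof (rule sum_mono)
    fix v assume "v \<in> {v\<in>V. w {v} \<noteq> 0}"
    then have v: "v \<in> V" by simp
    then have "wdeg V w {v} \<le> B * (W / real (card V)) * t ^ (card {v} - 1)"
      using sp unfolding spread_def W_def by blast
    then show "w {v} \<le> B * (W / real (card V))" using single[OF v] by simp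
  qed
  also have "\<dots> = real (card {v\<in>V. w {v} \<noteq> 0}) * (B * (W / real (card V)))" by simp
  finally have *: "W \<le> real (card {v\<in>V. w {v} \<noteq> 0}) * (B * (W / real (card V)))" .
  have cV: "0 < real (card V)" using V by (simp add: card_gt_0_iff)
  have W0: "0 < W" using W by (simp add: W_def)
  from * have "W * real (card V) \<le> W * (real (card {v\<in>V. w {v} \<noteq> 0}) * B)"
    using cV by (simp add: field_simps)
  then have "real (card V) \<le> real (card {v\<in>V. w {v} \<noteq> 0}) * B" using W0 by simp
  then have 1: "real (card V) / B \<le> real (card {v\<in>V. w {v} \<noteq> 0})" using B by (simp add: field_simps)
  have "card V = card {v\<in>V. w {v} = 0} + card {v\<in>V. w {v} \<noteq> 0}"
    using V by (subst card_Un_disjoint[symmetric]) (auto intro: arg_cong[where f=card])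
  then have "real (card V) = real (card {v\<in>V. w {v} = 0}) + real (card {v\<in>V. w {v} \<noteq> 0})" by simp
  then have "real (card {v\<in>V. w {v} = 0}) \<le> real (card V) - real (card V) / B" using 1 by linarith
  then show ?thesis by (simp add: algebra_simps)
qed

definition container_cover :: "('a set \<Rightarrow> bool) \<Rightarrow> 'a set \<Rightarrow> nat \<Rightarrow> real \<Rightarrow> bool" where
  "container_cover P V k s \<longleftrightarrow>
     (\<exists>\<C>. finite \<C> \<and> card \<C> \<le> k \<and> (\<forall>C\<in>\<C>. C \<subseteq> V \<and> real (card C) \<le> s) \<and>
       (\<forall>I\<subseteq>V. I \<noteq> {} \<and> P I \<longrightarrow> (\<exists>C\<in>\<C>. I \<subseteq> C)))"

lemma container_coverI:
  assumes "finite \<C>" "card \<C> \<le> k" "\<And>C. C \<in> \<C> \<Longrightarrow> C \<subseteq> V \<and> real (card C) \<le> s"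
    "\<And>I. I \<subseteq> V \<Longrightarrow> I \<noteq> {} \<Longrightarrow> P I \<Longrightarrow> \<exists>C\<in>\<C>. I \<subseteq> C"
  shows "container_cover P V k s"
  unfolding container_cover_def using assms by blast

lemma container_cover_mono:
  assumes "container_cover P V k s" "k \<le> k'" "s \<le> s'" "\<And>I. I \<subseteq> V \<Longrightarrow> Q I \<Longrightarrow> P I"
  shows "container_cover Q V k' s'"
proof -
  obtain \<C> where "finite \<C>" "card \<C> \<le> k" "\<forall>C\<in>\<C>. C \<subseteq> V \<and> real (card C) \<le> s"
    "\<forall>I\<subseteq>V. I \<noteq> {} \<and> P I \<longrightarrow> (\<exists>C\<in>\<C>. I \<subseteq> C)"
    using assms(1) unfolding container_cover_def by (elim exE conjE)
  then show ?thesis using assms(2-4) by (intro container_coverI[of \<C>]) (auto intro: order_trans)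
qed

lemma container_cover_single:
  assumes "C \<subseteq> V" "real (card C) \<le> s" "0 < k" "\<And>I. I \<subseteq> V \<Longrightarrow> P I \<Longrightarrow> I \<subseteq> C"
  shows "container_cover P V k s"
  using assms by (intro container_coverI[of "{C}"]) auto

lemma container_cover_Union:
  assumes L: "finite L" and sub: "\<And>x. x \<in> L \<Longrightarrow> U x \<subseteq> V"
    and cover: "\<And>x. x \<in> L \<Longrightarrow> container_cover (P x) (U x) k s"
    and part: "\<And>I. I \<subseteq> V \<Longrightarrow> I \<noteq> {} \<Longrightarrow> Q I \<Longrightarrow> \<exists>x\<in>L. I \<subseteq> U x \<and> P x I"
  shows "container_cover Q V (card L * k) s"
proof -
  have "\<forall>x\<in>L. \<exists>\<D>. finite \<D> \<and> card \<D> \<le> k \<and> (\<forall>C\<in>\<D>. C \<subseteq> U x \<and> real (card C) \<le> s) \<and>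
       (\<forall>I\<subseteq>U x. I \<noteq> {} \<and> P x I \<longrightarrow> (\<exists>C\<in>\<D>. I \<subseteq> C))"
    using cover unfolding container_cover_def by blast
  then obtain \<D> where \<D>: "\<And>x. x \<in> L \<Longrightarrow> finite (\<D> x) \<and> card (\<D> x) \<le> k \<and>
      (\<forall>C\<in>\<D> x. C \<subseteq> U x \<and> real (card C) \<le> s) \<and>
       (\<forall>I\<subseteq>U x. I \<noteq> {} \<and> P x I \<longrightarrow> (\<exists>C\<in>\<D> x. I \<subseteq> C))"
    by metis
  show ?thesis
  proof (rule container_coverI[of "\<Union>x\<in>L. \<D> x"])
    show "finite (\<Union>x\<in>L. \<D> x)" using L \<D> by blast
    have "card (\<Union>x\<in>L. \<D> x) \<le> (\<Sum>x\<in>L. card (\<D> x))" using L by (rule card_UN_le)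
    also have "\<dots> \<le> (\<Sum>x\<in>L. k)" using \<D> by (intro sum_mono) auto
    finally show "card (\<Union>x\<in>L. \<D> x) \<le> card L * k" by simp
    show "C \<subseteq> V \<and> real (card C) \<le> s" if "C \<in> (\<Union>x\<in>L. \<D> x)" for C
      using that \<D> sub by blast
    show "\<exists>C\<in>\<Union>x\<in>L. \<D> x. I \<subseteq> C" if "I \<subseteq> V" "I \<noteq> {}" "Q I" for I
      using part[OF that] \<D> that by (metis UN_I)
  qed
qed

text \<open>
  The container lemma, by induction on the uniformity.  Given an independent set \<open>I\<close>, let \<open>xs\<close> be the greedy list
  of \<open>b\<close> elements of \<open>I\<close>.  If the accumulated links have weight at least \<open>W * t / 4\<close>, which up to a constant
  factor is what \<open>b\<close> vertices of average degree contribute, then they form a hypergraph of smaller uniformity which is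
  again spread, and the induction hypothesis provides a container.  Otherwise \<open>I\<close> lies in the set of
  vertices of small gain.  By \<open>sum_gain_ge\<close> the gains still add up to a constant fraction of
  \<open>W\<close>, and no gain exceeds the maximum degree, so this set misses a constant fraction of \<open>V\<close>.
  As only the list matters, at most \<open>card V ^ b\<close> choices are made at each of the \<open>l\<close> levels.
\<close>

lemma containers:
  assumes "0 < l" and "1 \<le> B"
  shows "\<exists>\<eta>>0. \<eta> \<le> 1 \<and> (\<forall>(V::'a set) w b. finite V \<longrightarrow> V \<noteq> {} \<longrightarrow> 0 < b \<longrightarrow> uniform_weight l w \<longrightarrow>
      0 < wdeg V w {} \<longrightarrow> spread V (real b / real (card V)) B w \<longrightarrow>
      container_cover (\<lambda>I. avoids I w) V (card V ^ (l * b)) ((1 - \<eta>) * real (card V)))"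
  using assms
proof (induction l arbitrary: B rule: nat_induct_non_zero)
  case 1
  show ?case
  proof (intro exI[of _ "1 / B"] conjI allI impI)
    fix V :: "'a set" and w b
    assume A: "finite V" "V \<noteq> {}" "0 < b" "uniform_weight 1 w" "0 < wdeg V w {}"
      "spread V (real b / real (card V)) B w"
    show "container_cover (\<lambda>I. avoids I w) V (card V ^ (1 * b)) ((1 - 1 / B) * real (card V))"
    proof (rule container_cover_single[of "{v\<in>V. w {v} = 0}"])
      show "real (card {v\<in>V. w {v} = 0}) \<le> (1 - 1 / B) * real (card V)"
        using containers_singletons[of V w B] A 1 by auto
    qed (use A in \<open>auto simp: avoids_def card_gt_0_iff\<close>)
  qed (use 1 in auto)
next
  case (Suc l)
  \<comment> \<open>The links inherit the codegree bound with \<open>2 ^ l + 1\<close> instead of \<open>1\<close>, and \<open>4\<close> comes from the lower bound \<open>W * t / 4\<close> for their weight.\<close>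
  define B' where "B' = 4 * (2 ^ l + 1) * B"
  have "1 * 1 \<le> (4 * (2 ^ l + 1)) * B" using Suc.prems by (intro mult_mono) auto
  then have B': "1 \<le> B'" by (simp add: B'_def)
  from Suc.IH[OF B'] obtain \<eta>' where \<eta>': "0 < \<eta>'" "\<eta>' \<le> 1"
    and IH: "\<forall>(V::'a set) w b. finite V \<longrightarrow> V \<noteq> {} \<longrightarrow> 0 < b \<longrightarrow> uniform_weight l w \<longrightarrow>
      0 < wdeg V w {} \<longrightarrow> spread V (real b / real (card V)) B' w \<longrightarrow>
      container_cover (\<lambda>I. avoids I w) V (card V ^ (l * b)) ((1 - \<eta>') * real (card V))"
    by (elim exE conjE)
  define \<eta> where "\<eta> = min \<eta>' (1 / (2 * B))"
  have \<eta>: "0 < \<eta>" "\<eta> \<le> 1" "\<eta> \<le> \<eta>'" "\<eta> \<le> 1 / (2 * B)" using \<eta>' Suc.prems by (auto simp: \<eta>_def)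
  show ?case
  proof (intro exI[of _ \<eta>] conjI allI impI \<eta>(1,2))
    fix V :: "'a set" and w b
    assume V: "finite V" "V \<noteq> {}" and b: "0 < b" and w: "uniform_weight (Suc l) w"
      and W0: "0 < wdeg V w {}" and spr: "spread V (real b / real (card V)) B w"
    define v where "v = real (card V)"
    define t where "t = real b / v"
    define W where "W = wdeg V w {}"
    \<comment> \<open>The caps are \<open>2 ^ l * t\<close> times the bounds for the degrees in \<open>w\<close>, so that \<open>sum_gain_ge\<close> applies with \<open>a = 1 / (2 ^ l * t)\<close>.\<close>
    define c where "c = (\<lambda>j. 2 ^ l * B * (W / v) * t ^ j)"
    define lk where "lk = links V c w"
    define C where "C = (\<lambda>xs. {u\<in>V. gain V c w (lk xs) u \<le> W / (4 * v)})"
    define L where "L = {xs. set xs \<subseteq> V \<and> length xs = b}"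
    define greedy where "greedy = (\<lambda>xs I. set xs \<subseteq> I \<and>
      (\<forall>u\<in>I. real b * gain V c w (lk xs) u \<le> wdeg V (lk xs) {}))"
    have W: "0 < W" using W0 by (simp add: W_def)
    have v: "0 < v" using V by (simp add: v_def card_gt_0_iff)
    have t: "0 < t" using v b by (simp add: t_def)
    have cpos: "0 < c j" for j using W v t Suc.prems by (simp add: c_def)
    have sp: "wdeg V w T \<le> B * (W / v) * t ^ (card T - 1)" if "T \<subseteq> V" "T \<noteq> {}" for T
      using spr that unfolding spread_def W_def v_def t_def by blast
    have lku: "uniform_weight l (lk xs)" for xs unfolding lk_def by (rule links_uniform[OF w])
    have finL: "finite L" and cardL: "card L = card V ^ b"
      unfolding L_def using V finite_lists_length_eq card_lists_length_eq by blast+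
    have sub_cover: "container_cover (\<lambda>I. avoids I w \<and> greedy xs I) V (card V ^ (l * b)) ((1 - \<eta>) * v)"
      if xs: "xs \<in> L" for xs
    proof (cases "W * t / 4 \<le> wdeg V (lk xs) {}")
      case True
      have "0 < W * t / 4" using W t by simp
      then have pos: "0 < wdeg V (lk xs) {}" using True by linarith
      have "spread V (real b / real (card V)) B' (lk xs)"
        unfolding spread_def
      proof (intro allI impI)
        fix T assume T: "T \<subseteq> V" "T \<noteq> {}"
        have fT: "finite T" using T V finite_subset by blast
        then obtain j where j: "card T = Suc j" using T by (metis card_eq_0_iff not0_implies_Suc)
        have "wdeg V (lk xs) T \<le> c (card T) + B * (W / v) * t ^ card T"
          unfolding lk_def
        proof (rule wdeg_links_le[OF V(1) w])
          show "set xs \<subseteq> V" using xs by (simp add: L_def)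
          show "0 \<le> B * (W / v) * t ^ card T" using W v t Suc.prems by simp
          fix x assume x: "x \<in> V - T"
          then have "wdeg V w (insert x T) \<le> B * (W / v) * t ^ (card (insert x T) - 1)"
            using T by (intro sp) auto
          then show "wdeg V w (insert x T) \<le> B * (W / v) * t ^ card T" using x fT by simp
        qed (use T cpos[THEN less_imp_le] in auto)
        also have "\<dots> = (2 ^ l + 1) * B * (t ^ j / v) * (W * t)"
          by (simp add: c_def j algebra_simps add_divide_distrib)
        also have "\<dots> \<le> (2 ^ l + 1) * B * (t ^ j / v) * (4 * wdeg V (lk xs) {})"
          using True t v Suc.prems by (intro mult_left_mono) auto
        also have "\<dots> = B' * (wdeg V (lk xs) {} / real (card V)) * (real b / real (card V)) ^ (card T - 1)"
          by (simp add: j B'_def t_def v_def)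
        finally show "wdeg V (lk xs) T \<le> B' * (wdeg V (lk xs) {} / real (card V)) * (real b / real (card V)) ^ (card T - 1)" .
      qed
      then have "container_cover (\<lambda>I. avoids I (lk xs)) V (card V ^ (l * b)) ((1 - \<eta>') * real (card V))"
        using IH V b lku pos by blast
      then show ?thesis
      proof (rule container_cover_mono)
        show "(1 - \<eta>') * real (card V) \<le> (1 - \<eta>) * v"
          unfolding v_def using \<eta> by (intro mult_right_mono) auto
        show "avoids I (lk xs)" if "avoids I w \<and> greedy xs I" for I
          using that unfolding lk_def greedy_def by (intro links_avoids) auto
      qed simp
    next
      case False
      have "real (Suc l) * (W - 1 / (2 ^ l * t) * 2 ^ l * wdeg V (lk xs) {}) \<le> (\<Sum>u\<in>V. gain V c w (lk xs) u)"
        unfolding W_def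
      proof (rule sum_gain_ge[OF V(1) w lku cpos])
        show "0 \<le> 1 / (2 ^ l * t)" using t by simp
        fix T assume T: "T \<subseteq> V" "T \<noteq> {}"
        then obtain j where j: "card T = Suc j"
          using V by (metis card_eq_0_iff not0_implies_Suc finite_subset)
        show "wdeg V w T \<le> 1 / (2 ^ l * t) * c (card T)"
          using sp[OF T] t by (simp add: c_def j field_simps)
      qed
      moreover have "1 / (2 ^ l * t) * 2 ^ l * wdeg V (lk xs) {} \<le> W / 4"
        using False t by (simp add: field_simps)
      ultimately have "real (Suc l) * (W - W / 4) \<le> (\<Sum>u\<in>V. gain V c w (lk xs) u)"
        by (smt (verit) mult_left_mono of_nat_0_le_iff)
      moreover have "1 * (W - W / 4) \<le> real (Suc l) * (W - W / 4)" using W by (intro mult_right_mono) auto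
      ultimately have "1 * (W - W / 4) \<le> (\<Sum>u\<in>V. gain V c w (lk xs) u)" by (rule order_trans[rotated])
      then have g1: "3 * W / 4 \<le> (\<Sum>u\<in>V. gain V c w (lk xs) u)" by simp
      have gle: "gain V c w (lk xs) u \<le> B * (W / v)" if u: "u \<in> V" for u
      proof -
        have "gain V c w (lk xs) u \<le> (\<Sum>f | {} \<subseteq> f \<and> f \<subseteq> V \<and> u \<notin> f. w (insert u f))"
          unfolding gain_def
        proof (rule sum_mono2)
          show "finite {f. {} \<subseteq> f \<and> f \<subseteq> V \<and> u \<notin> f}"
            using V by (auto intro: finite_subset[of _ "Pow V"])
        qed (use w in \<open>auto simp: uniform_weight_def\<close>)
        also have "\<dots> = wdeg V w {u}" using u by (intro sum_insert_eq_wdeg) auto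
        also have "\<dots> \<le> B * (W / v)" using sp[of "{u}"] u by simp
        finally show ?thesis .
      qed
      have sub: "C xs \<subseteq> V" by (auto simp: C_def)
      have "(\<Sum>u\<in>V. gain V c w (lk xs) u) = (\<Sum>u\<in>V - C xs. gain V c w (lk xs) u) + (\<Sum>u\<in>C xs. gain V c w (lk xs) u)"
        by (rule sum.subset_diff[OF sub V(1)])
      also have "\<dots> \<le> (\<Sum>u\<in>V - C xs. B * (W / v)) + (\<Sum>u\<in>C xs. W / (4 * v))"
        using gle by (intro add_mono sum_mono) (auto simp: C_def)
      also have "\<dots> = (v - real (card (C xs))) * (B * (W / v)) + real (card (C xs)) * (W / (4 * v))"
        using V sub by (simp add: card_Diff_subset finite_subset[OF sub] v_def of_nat_diff card_mono)
      finally have g2: "(\<Sum>u\<in>V. gain V c w (lk xs) u)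
        \<le> (v - real (card (C xs))) * (B * (W / v)) + real (card (C xs)) * (W / (4 * v))" .
      have "real (card (C xs)) * (W / (4 * v)) \<le> v * (W / (4 * v))"
        using V sub W v unfolding v_def by (intro mult_right_mono) (auto intro: card_mono)
      also have "\<dots> = W / 4" using v by simp
      finally have "W / 2 \<le> (v - real (card (C xs))) * (B * (W / v))" using g1 g2 by linarith
      then have "W * (v / (2 * B)) \<le> W * (v - real (card (C xs)))"
        using v Suc.prems by (simp add: field_simps)
      then have "v / (2 * B) \<le> v - real (card (C xs))" using W by (simp only: mult_le_cancel_left_pos)
      then have "real (card (C xs)) \<le> (1 - 1 / (2 * B)) * v" by (simp add: algebra_simps)
      also have "\<dots> \<le> (1 - \<eta>) * v" using \<eta> v by (intro mult_right_mono) auto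
      finally have cardC: "real (card (C xs)) \<le> (1 - \<eta>) * v" .
      show ?thesis
      proof (rule container_cover_single[OF sub cardC])
        fix I assume I: "I \<subseteq> V" "avoids I w \<and> greedy xs I"
        show "I \<subseteq> C xs"
        proof
          fix u assume u: "u \<in> I"
          then have "real b * gain V c w (lk xs) u \<le> W * t / 4"
            using I False unfolding greedy_def by fastforce
          then have "gain V c w (lk xs) u \<le> W / (4 * v)"
            using b v by (simp add: t_def field_simps)
          then show "u \<in> C xs" using u I by (auto simp: C_def)
        qed
      qed (use V in \<open>auto simp: card_gt_0_iff\<close>)
    qed
    have "container_cover (\<lambda>I. avoids I w) V (card L * card V ^ (l * b)) ((1 - \<eta>) * v)"
    proof (rule container_cover_Union[OF finL _ sub_cover])
      fix I assume I: "I \<subseteq> V" "I \<noteq> {}" "avoids I w"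
      obtain xs where xs: "set xs \<subseteq> I" "length xs = b"
        "\<forall>u\<in>I. real b * gain V c w (lk xs) u \<le> wdeg V (lk xs) {}"
        using greedy_links[OF V(1) w, of I b c] I V unfolding lk_def by (metis finite_subset)
      then have "xs \<in> L" using I by (auto simp: L_def)
      then show "\<exists>xs\<in>L. I \<subseteq> V \<and> avoids I w \<and> greedy xs I" using I xs by (auto simp: greedy_def)
    qed auto
    then show "container_cover (\<lambda>I. avoids I w) V (card V ^ (Suc l * b)) ((1 - \<eta>) * real (card V))"
      by (simp add: cardL power_add v_def)
  qed
qed

section \<open>Coincidences between sums\<close>

lemma card_subsets_le_power:
  assumes "finite V"
  shows "card {X. X \<subseteq> V \<and> card X = k} \<le> card V ^ k"
proof (cases "k \<le> card V")
  case True
  then show ?thesis using assms by (simp add: n_subsets binomial_le_pow)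
qed (use assms in \<open>simp add: n_subsets binomial_eq_0\<close>)

text \<open>
  Cauchy--Schwarz applied to the sizes of the fibres of \<open>f\<close>.
\<close>

lemma card_fibre_pairs:
  assumes "finite A"
  shows "(card A)\<^sup>2 \<le> card (f ` A) * card {(x, y) \<in> A \<times> A. f x = f y}"
proof -
  define r where "r = (\<lambda>s. card {x\<in>A. f x = s})"
  define P where "P = {(x, y) \<in> A \<times> A. f x = f y}"
  have A: "real (card A) = (\<Sum>s\<in>f ` A. real (r s))"
    using sum.image_gen[OF assms, of "\<lambda>_. 1::real" f] by (simp add: r_def)
  have "card P = (\<Sum>s\<in>f ` A. card ({x\<in>A. f x = s} \<times> {y\<in>A. f y = s}))"
    unfolding P_def
    by (subst card_UN_disjoint[symmetric]) (use assms in \<open>auto intro!: arg_cong[where f=card]\<close>)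
  then have P: "real (card P) = (\<Sum>s\<in>f ` A. (real (r s))\<^sup>2)"
    by (simp add: card_cartesian_product r_def power2_eq_square)
  have "(real (card A))\<^sup>2 \<le> (\<Sum>s\<in>f ` A. (real (r s))\<^sup>2) * real (card (f ` A))"
    unfolding A by (rule sum_squared_le_sum_of_squares)
  then have "real ((card A)\<^sup>2) \<le> real (card (f ` A) * card P)"
    using P by (simp add: mult.commute)
  then show ?thesis unfolding P_def by (simp only: of_nat_le_iff)
qed

definition subset_sums :: "nat \<Rightarrow> 'a::ab_group_add set \<Rightarrow> 'a set" where
  "subset_sums h V = \<Sum> ` {X. X \<subseteq> V \<and> card X = h}"

text \<open>
  The vertex sets of the solutions of $x_1+\dots+x_h = y_1+\dots+y_h$ in $2h$ distinct elements of
  \<open>V\<close>.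
\<close>

definition coincidences :: "nat \<Rightarrow> 'a::ab_group_add set \<Rightarrow> 'a set set" where
  "coincidences h V = {X \<union> Y | X Y. X \<subseteq> V \<and> Y \<subseteq> V \<and> X \<inter> Y = {} \<and> card X = h \<and> card Y = h \<and> \<Sum>X = \<Sum>Y}"

definition coincidence_free :: "nat \<Rightarrow> 'a::ab_group_add set \<Rightarrow> bool" where
  "coincidence_free h Q \<longleftrightarrow> coincidences h Q = {}"

lemma subset_sums_mono: "U \<subseteq> V \<Longrightarrow> subset_sums h U \<subseteq> subset_sums h V"
  by (auto simp: subset_sums_def)

lemma finite_subset_sums: "finite V \<Longrightarrow> finite (subset_sums h V)"
  by (auto simp: subset_sums_def)

lemma coincidencesE:
  assumes "Z \<in> coincidences h V"
  obtains X Y where "Z = X \<union> Y" "X \<subseteq> V" "Y \<subseteq> V" "X \<inter> Y = {}" "card X = h" "card Y = h" "\<Sum>X = \<Sum>Y"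
  using assms unfolding coincidences_def mem_Collect_eq by (elim exE conjE) (rule that)

lemma coincidencesI:
  assumes "X \<subseteq> V" "Y \<subseteq> V" "X \<inter> Y = {}" "card X = h" "card Y = h" "\<Sum>X = \<Sum>Y"
  shows "X \<union> Y \<in> coincidences h V"
  unfolding coincidences_def mem_Collect_eq using assms by (intro exI[of _ X] exI[of _ Y] conjI refl)

lemma coincidences_within: "Z \<in> coincidences h V \<Longrightarrow> Z \<subseteq> U \<Longrightarrow> Z \<in> coincidences h U"
  by (elim coincidencesE) (simp add: coincidencesI)

lemma coincidences_subset: "Z \<in> coincidences h V \<Longrightarrow> Z \<subseteq> V"
  by (elim coincidencesE) simp

lemma coincidences_mono: "U \<subseteq> V \<Longrightarrow> coincidences h U \<subseteq> coincidences h V"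
  by (meson coincidences_subset coincidences_within order_trans subsetI)

lemma finite_coincidences: "finite V \<Longrightarrow> finite (coincidences h V)"
  by (rule finite_subset[of _ "Pow V"]) (auto dest: coincidences_subset)

lemma card_coincidence: 
  assumes "finite V" "Z \<in> coincidences h V" 
  shows "card Z = 2 * h"
proof -
  obtain X Y where Z: "Z = X \<union> Y" "X \<subseteq> V" "Y \<subseteq> V" "X \<inter> Y = {}" "card X = h" "card Y = h"
    using assms(2) by (rule coincidencesE)
  then have "finite X" "finite Y" using assms finite_subset by auto
  then show ?thesis using Z by (simp add: card_Un_disjoint)
qed

lemma coincidence_free_subset: "coincidence_free h Q \<Longrightarrow> R \<subseteq> Q \<Longrightarrow> coincidence_free h R"
  unfolding coincidence_free_def using coincidences_mono[of R Q h] by auto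

text \<open>
  These pairs are the degenerate ones among the pairs of equal sum.  A common element, the rest of
  \<open>X\<close> and all but one of the remaining elements of \<open>Y\<close> determine the pair, so there are two degrees of
  freedom less than for arbitrary pairs.
\<close>

lemma card_intersecting_pairs:
  fixes V :: "'a::ab_group_add set"
  assumes V: "finite V" and h: "2 \<le> h"
  shows "card {(X, Y). X \<subseteq> V \<and> card X = h \<and> Y \<subseteq> V \<and> card Y = h \<and> \<Sum>X = \<Sum>Y \<and> X \<inter> Y \<noteq> {}}
    \<le> card V ^ (2 * h - 2)" (is "card ?D \<le> _")
proof -
  define S where "S = (\<lambda>k. {X. X \<subseteq> V \<and> card X = k})"
  define F where "F = (\<lambda>(z, X::'a set, Y). (insert z X, insert z (insert (\<Sum>X - \<Sum>Y) Y)))"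
  have "?D \<subseteq> F ` (V \<times> S (h - 1) \<times> S (h - 2))"
  proof
    fix p assume "p \<in> ?D"
    then obtain X Y where p: "p = (X, Y)" and X: "X \<subseteq> V" "card X = h" and Y: "Y \<subseteq> V" "card Y = h"
      and eq: "\<Sum>X = \<Sum>Y" and ne: "X \<inter> Y \<noteq> {}" by auto
    obtain z where z: "z \<in> X" "z \<in> Y" using ne by blast
    have fin: "finite X" "finite Y" using X Y V finite_subset by auto
    have "card (Y - {z}) \<noteq> 0" using z fin X Y h by simp
    then obtain y where y: "y \<in> Y - {z}" by (metis card.empty ex_in_conv)
    define X' where "X' = X - {z}"
    define Y' where "Y' = Y - {z} - {y}"
    have "\<Sum>X = z + \<Sum>X'" using z fin unfolding X'_def by (intro sum.remove) auto
    moreover have "\<Sum>Y = z + \<Sum>(Y - {z})" using z fin by (intro sum.remove) auto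
    moreover have "\<Sum>(Y - {z}) = y + \<Sum>Y'" using y fin unfolding Y'_def by (intro sum.remove) auto
    ultimately have "\<Sum>X' - \<Sum>Y' = y" using eq by (simp add: algebra_simps)
    moreover have "insert z X' = X" "insert z (insert y Y') = Y" using z y by (auto simp: X'_def Y'_def)
    ultimately have "(X, Y) = F (z, X', Y')" by (simp add: F_def)
    moreover have "(z, X', Y') \<in> V \<times> S (h - 1) \<times> S (h - 2)"
      using X Y z y fin by (auto simp: S_def X'_def Y'_def)
    ultimately show "p \<in> F ` (V \<times> S (h - 1) \<times> S (h - 2))" unfolding p by (rule image_eqI)
  qed
  moreover have finS: "finite (S k)" for k using V by (auto simp: S_def)
  ultimately have "card ?D \<le> card (V \<times> S (h - 1) \<times> S (h - 2))"
    using V by (intro surj_card_le) auto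
  also have "\<dots> = card V * (card (S (h - 1)) * card (S (h - 2)))"
    by (simp add: card_cartesian_product)
  also have "\<dots> \<le> card V * (card V ^ (h - 1) * card V ^ (h - 2))"
    unfolding S_def using V by (intro mult_le_mono card_subsets_le_power) auto
  also have "\<dots> = card V ^ (1 + (h - 1) + (h - 2))" by (simp only: power_add power_one_right mult.assoc)
  also have "1 + (h - 1) + (h - 2) = 2 * h - 2" using h by simp
  finally show ?thesis .
qed

text \<open>
  By \<open>card_fibre_pairs\<close> there are many pairs of \<open>h\<close>-sets with equal sum, because the sums take at most
  \<open>K\<close> values.  The hypothesis \<open>big\<close> makes at most half of them degenerate, and one union
  \<open>X \<union> Y\<close> comes from at most \<open>4 ^ h\<close> pairs.
\<close>

lemma card_coincidences_ge:
  fixes V :: "'a::ab_group_add set"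
  assumes V: "finite V" and h: "2 \<le> h" "h \<le> card V" and K: "card (subset_sums h V) \<le> K" "0 < K"
    and big: "2 * real h ^ (2 * h) * real K \<le> (real (card V))\<^sup>2"
  shows "real (card V) ^ (2 * h) / (2 * real h ^ (2 * h) * 4 ^ h * real K) \<le> real (card (coincidences h V))"
proof -
  define S where "S = {X. X \<subseteq> V \<and> card X = h}"
  define P where "P = {(X, Y) \<in> S \<times> S. \<Sum>X = \<Sum>Y}"
  define D where "D = {(X, Y). X \<subseteq> V \<and> card X = h \<and> Y \<subseteq> V \<and> card Y = h \<and> \<Sum>X = \<Sum>Y \<and> X \<inter> Y \<noteq> {}}"
  define E where "E = coincidences h V"
  define v where "v = real (card V)"
  define q where "q = v ^ (2 * h) / (real h ^ (2 * h) * real K)"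
  have v: "0 < v" using h by (simp add: v_def)
  have q: "0 < q" using v h K by (simp add: q_def)
  have finS: "finite S" using V by (auto simp: S_def)
  have finP: "finite P" unfolding P_def by (rule finite_subset[of _ "S \<times> S"]) (use finS in auto)
  have finE: "finite E" using V by (simp add: E_def finite_coincidences)
  have DP: "D \<subseteq> P" by (auto simp: D_def P_def S_def)
  have "(card S)\<^sup>2 \<le> card (subset_sums h V) * card P"
    using card_fibre_pairs[OF finS, of \<Sum>] by (simp add: subset_sums_def S_def P_def)
  also have "\<dots> \<le> K * card P" using K by simp
  finally have "(real (card S))\<^sup>2 \<le> real K * real (card P)"
    by (metis of_nat_le_iff of_nat_mult of_nat_power)
  moreover have "(v / real h) ^ h \<le> real (card S)"
    using binomial_ge_n_over_k_pow_k[of h "card V", where ?'a=real] h V by (simp add: v_def S_def n_subsets)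
  then have "((v / real h) ^ h)\<^sup>2 \<le> (real (card S))\<^sup>2" using v by (intro power_mono) auto
  ultimately have "((v / real h) ^ h)\<^sup>2 \<le> real K * real (card P)" by linarith
  then have "v ^ (2 * h) / real h ^ (2 * h) \<le> real K * real (card P)"
    by (simp add: power_divide power_mult[symmetric] mult.commute)
  then have "v ^ (2 * h) / real h ^ (2 * h) / real K \<le> real (card P)"
    using K by (subst pos_divide_le_eq) (auto simp: mult.commute)
  then have cardP: "q \<le> real (card P)" by (simp add: q_def)
  have "real (card D) \<le> real (card V ^ (2 * h - 2))"
    unfolding of_nat_le_iff D_def by (rule card_intersecting_pairs[OF V h(1)])
  then have "real (card D) \<le> v ^ (2 * h - 2)" by (simp add: v_def)
  also have "\<dots> \<le> q / 2"
  proof -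
    have "v ^ (2 * h - 2) * (2 * real h ^ (2 * h) * real K) \<le> v ^ (2 * h - 2) * v\<^sup>2"
      using big v unfolding v_def by (intro mult_left_mono) auto
    also have "\<dots> = v ^ (2 * h - 2 + 2)" by (simp only: power_add)
    also have "2 * h - 2 + 2 = 2 * h" using h by simp
    finally have "v ^ (2 * h - 2) \<le> v ^ (2 * h) / (2 * real h ^ (2 * h) * real K)"
      using h K by (subst pos_le_divide_eq) auto
    then show ?thesis by (simp add: q_def mult.assoc)
  qed
  finally have cardD: "real (card D) \<le> q / 2" .
  have "P - D \<subseteq> (\<Union>Z\<in>E. (\<lambda>X. (X, Z - X)) ` Pow Z)"
  proof
    fix p assume "p \<in> P - D"
    then obtain X Y where p: "p = (X, Y)" and XY: "(X, Y) \<in> P" "(X, Y) \<notin> D" by (cases p) auto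
    then have "X \<subseteq> V" "Y \<subseteq> V" "X \<inter> Y = {}" "card X = h" "card Y = h" "\<Sum>X = \<Sum>Y"
      by (auto simp: P_def D_def S_def)
    then have "X \<union> Y \<in> E" "(X, Y) = (X, X \<union> Y - X)" "X \<in> Pow (X \<union> Y)"
      unfolding E_def by (auto intro: coincidencesI)
    then show "p \<in> (\<Union>Z\<in>E. (\<lambda>X. (X, Z - X)) ` Pow Z)" unfolding p by blast
  qed
  moreover have finZ: "finite Z" if "Z \<in> E" for Z
    using that V unfolding E_def by (meson coincidences_subset finite_subset)
  ultimately have "card (P - D) \<le> card (\<Union>Z\<in>E. (\<lambda>X. (X, Z - X)) ` Pow Z)"
    using finE by (intro card_mono) auto
  also have "\<dots> \<le> (\<Sum>Z\<in>E. card ((\<lambda>X. (X, Z - X)) ` Pow Z))" by (rule card_UN_le[OF finE])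
  also have "\<dots> \<le> (\<Sum>Z\<in>E. 4 ^ h)"
  proof (rule sum_mono)
    fix Z assume Z: "Z \<in> E"
    have "card ((\<lambda>X. (X, Z - X)) ` Pow Z) \<le> card (Pow Z)" using finZ[OF Z] by (intro card_image_le) auto
    also have "\<dots> = 4 ^ h"
      using card_coincidence[OF V, of Z h] Z finZ[OF Z] by (simp add: E_def card_Pow power_mult)
    finally show "card ((\<lambda>X. (X, Z - X)) ` Pow Z) \<le> 4 ^ h" .
  qed
  finally have "card (P - D) \<le> card E * 4 ^ h" by simp
  then have "real (card (P - D)) \<le> real (card E * 4 ^ h)" by (simp only: of_nat_le_iff)
  moreover have "real (card (P - D)) = real (card P) - real (card D)"
    using DP finP by (simp add: card_Diff_subset finite_subset of_nat_diff card_mono)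
  ultimately have "q / 2 \<le> real (card E) * 4 ^ h" using cardP cardD by simp
  then have "q / 2 / 4 ^ h \<le> real (card E)" by (simp add: pos_divide_le_eq)
  moreover have "q / 2 / 4 ^ h = v ^ (2 * h) / (2 * real h ^ (2 * h) * 4 ^ h * real K)"
    by (simp add: q_def mult_ac)
  ultimately show ?thesis by (simp add: E_def v_def)
qed

text \<open>
  All but one of the elements outside \<open>T\<close> may be chosen freely; together with the partition into
  \<open>X\<close> and \<open>Y\<close> they determine the last one.
\<close>

lemma card_coincidences_containing:
  fixes V :: "'a::ab_group_add set"
  assumes V: "finite V" and T: "T \<subseteq> V" "card T < 2 * h"
  shows "card {Z \<in> coincidences h V. T \<subseteq> Z} \<le> 4 ^ h * card V ^ (2 * h - 1 - card T)"
proof -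
  define k where "k = 2 * h - 1 - card T"
  define S where "S = {R. R \<subseteq> V \<and> card R = k}"
  define F where "F = (\<lambda>R. (\<lambda>X. insert (\<Sum>(T \<union> R - X) - \<Sum>X) (T \<union> R)) ` Pow (T \<union> R))"
  have finT: "finite T" using T V finite_subset by auto
  have finS: "finite S" using V by (auto simp: S_def)
  have finR: "finite R" if "R \<in> S" for R using that V finite_subset by (auto simp: S_def)
  have "{Z \<in> coincidences h V. T \<subseteq> Z} \<subseteq> (\<Union>R\<in>S. F R)"
  proof
    fix Z assume "Z \<in> {Z \<in> coincidences h V. T \<subseteq> Z}"
    then have Z: "Z \<in> coincidences h V" "T \<subseteq> Z" by auto
    have cZ: "card Z = 2 * h" using Z V card_coincidence by blast
    have ZV: "Z \<subseteq> V" using Z coincidences_subset by blast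
    have finZ: "finite Z" using ZV V finite_subset by auto
    have "T \<noteq> Z" using cZ T by auto
    then obtain z where z: "z \<in> Z" "z \<notin> T" using Z by blast
    obtain X Y where XY: "Z = X \<union> Y" "X \<inter> Y = {}" "\<Sum>X = \<Sum>Y" "z \<in> X"
    proof -
      obtain X Y where "Z = X \<union> Y" "X \<inter> Y = {}" "\<Sum>X = \<Sum>Y"
        using Z(1) by (rule coincidencesE)
      then show ?thesis using z that[of X Y] that[of Y X] by auto
    qed
    define R where "R = Z - T - {z}"
    have TR: "T \<union> R = Z - {z}" using z Z by (auto simp: R_def)
    have "card R = k" using z Z cZ finT finZ by (simp add: R_def k_def card_Diff_subset)
    then have "R \<in> S" using ZV by (auto simp: S_def R_def)
    moreover have "Z \<in> F R"
    proof -
      have "T \<union> R - (X - {z}) = Y" unfolding TR using XY by auto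
      moreover have "\<Sum>X = z + \<Sum>(X - {z})" using XY finZ by (intro sum.remove) auto
      ultimately have "\<Sum>(T \<union> R - (X - {z})) - \<Sum>(X - {z}) = z" using XY by simp
      moreover have "insert z (T \<union> R) = Z" unfolding TR using z by auto
      moreover have "X - {z} \<in> Pow (T \<union> R)" unfolding TR using XY by auto
      ultimately show ?thesis unfolding F_def by (metis (no_types, lifting) imageI)
    qed
    ultimately show "Z \<in> (\<Union>R\<in>S. F R)" by blast
  qed
  moreover have "finite (F R)" if "R \<in> S" for R using finT finR[OF that] by (simp add: F_def)
  ultimately have "card {Z \<in> coincidences h V. T \<subseteq> Z} \<le> card (\<Union>R\<in>S. F R)"
    using finS by (intro card_mono) auto
  also have "\<dots> \<le> (\<Sum>R\<in>S. card (F R))" by (rule card_UN_le[OF finS])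
  also have "\<dots> \<le> (\<Sum>R\<in>S. 4 ^ h)"
  proof (rule sum_mono)
    fix R assume R: "R \<in> S"
    have "card (F R) \<le> card (Pow (T \<union> R))" unfolding F_def using finT finR[OF R] by (intro card_image_le) auto
    also have "\<dots> = 2 ^ card (T \<union> R)" using finT finR[OF R] by (simp add: card_Pow)
    also have "\<dots> \<le> 2 ^ (2 * h)"
    proof (rule power_increasing)
      have "card (T \<union> R) \<le> card T + card R" by (rule card_Un_le)
      also have "\<dots> \<le> 2 * h" using R T by (simp add: S_def k_def)
      finally show "card (T \<union> R) \<le> 2 * h" .
    qed simp
    finally show "card (F R) \<le> 4 ^ h" by (simp add: power_mult)
  qed
  also have "\<dots> = 4 ^ h * card S" by simp
  also have "\<dots> \<le> 4 ^ h * card V ^ k"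
    unfolding S_def using V by (intro mult_le_mono card_subsets_le_power) auto
  finally show ?thesis by (simp add: k_def)
qed

text \<open>
  The coincidences may be concentrated on a few elements of \<open>V\<close>, whereas the container lemma
  needs a bounded maximum degree.  Take a maximal subfamily whose degrees are at most
  \<open>4 * r * E / card V\<close>.  If more than half of the vertices have a degree so close to this bound that they cannot take another set,
  then the subfamily is large.  Otherwise no set inside the other half can be missing from it, and there are at
  least \<open>E\<close> such sets.
\<close>

lemma bounded_degree_subfamily:
  fixes E :: real and V :: "'a set"
  assumes V: "finite V" "V \<noteq> {}" and F: "\<And>Z. Z \<in> \<F> \<Longrightarrow> Z \<subseteq> V \<and> card Z = r" and r: "0 < r"
    and E: "real (card V) \<le> 2 * real r * E"
    and half: "\<And>U. U \<subseteq> V \<Longrightarrow> card V \<le> 2 * card U \<Longrightarrow> E \<le> real (card {Z\<in>\<F>. Z \<subseteq> U})"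
  obtains H where "H \<subseteq> \<F>" "E \<le> real (card H)"
    "\<And>u. real (card {Z\<in>H. u \<in> Z}) \<le> 4 * real r * E / real (card V)"
proof -
  define v where "v = real (card V)"
  define \<Delta> where "\<Delta> = 4 * real r * E / v"
  define deg where "deg = (\<lambda>H (u::'a). real (card {Z\<in>H. u \<in> Z}))"
  have v: "0 < v" using V by (simp add: v_def card_gt_0_iff)
  have \<Delta>2: "2 \<le> \<Delta>" using E v by (simp add: \<Delta>_def v_def field_simps)
  have finF: "finite \<F>" by (rule finite_subset[of _ "Pow V"]) (use F V in auto)
  define \<H> where "\<H> = {H. H \<subseteq> \<F> \<and> (\<forall>u. deg H u \<le> \<Delta>)}"
  have "finite \<H>" by (rule finite_subset[of _ "Pow \<F>"]) (use finF in \<open>auto simp: \<H>_def\<close>)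
  moreover have "{} \<in> \<H>" using \<Delta>2 by (simp add: \<H>_def deg_def)
  ultimately obtain H where H: "H \<in> \<H>" and max: "\<And>H'. H' \<in> \<H> \<Longrightarrow> H \<subseteq> H' \<Longrightarrow> H = H'"
    using finite_has_maximal[of \<H>] by blast
  have HF: "H \<subseteq> \<F>" and deg: "\<And>u. deg H u \<le> \<Delta>" using H by (auto simp: \<H>_def)
  have finH: "finite H" using HF finF finite_subset by auto
  \<comment> \<open>The vertices that can still be used by another set.\<close>
  define U where "U = {u\<in>V. deg H u + 1 \<le> \<Delta>}"
  have UV: "U \<subseteq> V" by (auto simp: U_def)
  have finU: "finite U" using UV V finite_subset by auto
  have "E \<le> real (card H)"
  proof (cases "card V \<le> 2 * card U")
    case True
    have "{Z\<in>\<F>. Z \<subseteq> U} \<subseteq> H"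
    proof clarify
      fix Z assume Z: "Z \<in> \<F>" "Z \<subseteq> U"
      have "deg (insert Z H) u \<le> \<Delta>" for u
      proof (cases "u \<in> Z")
        case True
        then have "{Y \<in> insert Z H. u \<in> Y} = insert Z {Y\<in>H. u \<in> Y}" by auto
        then have "deg (insert Z H) u \<le> deg H u + 1"
          using finH unfolding deg_def by (simp add: card_insert_if)
        then show ?thesis using True Z by (auto simp: U_def)
      next
        case False
        then have "{Y \<in> insert Z H. u \<in> Y} = {Y\<in>H. u \<in> Y}" by auto
        then show ?thesis using deg[of u] by (simp add: deg_def)
      qed
      then have "insert Z H \<in> \<H>" using HF Z by (simp add: \<H>_def)
      then show "Z \<in> H" using max[of "insert Z H"] by blast
    qed
    then have "card {Z\<in>\<F>. Z \<subseteq> U} \<le> card H" using finH by (intro card_mono)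
    then show ?thesis using half[OF UV True] by linarith
  next
    case False
    have "real (card (V - U)) * (\<Delta> / 2) = (\<Sum>u\<in>V - U. \<Delta> / 2)" by simp
    also have "\<dots> \<le> (\<Sum>u\<in>V - U. deg H u)"
      by (intro sum_mono) (use \<Delta>2 in \<open>auto simp: U_def\<close>)
    also have "\<dots> \<le> (\<Sum>u\<in>V. deg H u)" using V by (intro sum_mono2) (auto simp: deg_def)
    also have "\<dots> = (\<Sum>u\<in>V. \<Sum>Z | Z \<in> H \<and> u \<in> Z. 1)" by (simp add: deg_def)
    also have "\<dots> = (\<Sum>Z\<in>H. \<Sum>u | u \<in> V \<and> u \<in> Z. 1)"
      by (rule sum.swap_restrict) (use V finH in auto)
    also have "\<dots> = (\<Sum>Z\<in>H. real r)"
    proof (rule sum.cong[OF refl])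
      fix Z assume "Z \<in> H"
      then have "Z \<subseteq> V" "card Z = r" using F HF by auto
      moreover then have "{u. u \<in> V \<and> u \<in> Z} = Z" by auto
      ultimately show "(\<Sum>u | u \<in> V \<and> u \<in> Z. 1) = real r" by simp
    qed
    finally have 1: "real (card (V - U)) * (\<Delta> / 2) \<le> real (card H) * real r" by simp
    have "real (card (V - U)) = v - real (card U)"
      using UV V finU by (simp add: card_Diff_subset v_def of_nat_diff card_mono)
    moreover have "2 * real (card U) \<le> v" using False by (simp add: v_def)
    ultimately have "v / 2 \<le> real (card (V - U))" by linarith
    then have "v / 2 * (\<Delta> / 2) \<le> real (card (V - U)) * (\<Delta> / 2)" using \<Delta>2 by (intro mult_right_mono) auto
    also have "v / 2 * (\<Delta> / 2) = real r * E" using v by (simp add: \<Delta>_def)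
    finally have "real r * E \<le> real r * real (card H)" using 1 by (simp add: mult.commute)
    then show ?thesis using r by (simp only: mult_le_cancel_left_pos of_nat_0_less_iff)
  qed
  then show ?thesis using that[OF HF] deg by (simp add: deg_def \<Delta>_def v_def)
qed

text \<open>
  The container lemma is applied to a subfamily of the coincidences in \<open>V\<close> with bounded degree.  The
  two conditions that relate \<open>K\<close> and \<open>b\<close> come from codegrees: sets of \<open>j\<close> points with
  $2 \le j < 2h$ require \<open>K \<le> b * card V\<close>, full coincidences require \<open>K \<le> b ^ (2 * h - 1)\<close>.
\<close>

lemma coincidence_containers_step:
  assumes h: "2 \<le> h"
  shows "\<exists>\<eta> c. 0 < \<eta> \<and> \<eta> \<le> 1 \<and> 0 < c \<and> (\<forall>(V::'a::ab_group_add set) K b. finite V \<longrightarrow> V \<noteq> {} \<longrightarrow> 0 < b \<longrightarrow> 0 < K \<longrightarrow>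
     card (subset_sums h V) \<le> K \<longrightarrow> c * real K \<le> (real (card V))\<^sup>2 \<longrightarrow> K \<le> b * card V \<longrightarrow> K \<le> b ^ (2 * h - 1) \<longrightarrow>
     container_cover (coincidence_free h) V (card V ^ (2 * h * b)) ((1 - \<eta>) * real (card V)))"
proof -
  \<comment> \<open>There are at least \<open>a * v ^ (2 * h) / K\<close> coincidences in a \<open>v\<close>-set; \<open>B\<close> and \<open>c\<close> collect the losses.\<close>
  define a :: real where "a = 1 / (2 * real h ^ (2 * h) * 4 ^ h)"
  define B :: real where "B = 8 * real h + 16 ^ h / a"
  define c :: real where "c = 8 * real h ^ (2 * h) + 4 ^ h / a"
  have a: "0 < a" using h by (simp add: a_def)
  have B8: "8 * real h \<le> B" and B16: "16 ^ h / a \<le> B" using a by (auto simp: B_def)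
  have B1: "1 \<le> B" using B8 h by linarith
  have c: "0 < c" using a by (auto simp: c_def intro!: add_nonneg_pos)
  have "0 < 2 * h" using h by simp
  from containers[OF this B1, where ?'a = 'a] obtain \<eta> where \<eta>: "0 < \<eta>" "\<eta> \<le> 1"
    and cont: "\<forall>(V::'a set) w b. finite V \<longrightarrow> V \<noteq> {} \<longrightarrow> 0 < b \<longrightarrow> uniform_weight (2 * h) w \<longrightarrow>
      0 < wdeg V w {} \<longrightarrow> spread V (real b / real (card V)) B w \<longrightarrow>
      container_cover (\<lambda>I. avoids I w) V (card V ^ (2 * h * b)) ((1 - \<eta>) * real (card V))"
    by (elim exE conjE)
  show ?thesis
  proof (rule exI[of _ \<eta>], rule exI[of _ c], intro conjI allI impI \<eta> c)
    fix V :: "'a set" and K b :: nat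
    assume V: "finite V" "V \<noteq> {}" and b: "0 < b" and K0: "0 < K" and K: "card (subset_sums h V) \<le> K"
      and big: "c * real K \<le> (real (card V))\<^sup>2" and Kb: "K \<le> b * card V" and Kbh: "K \<le> b ^ (2 * h - 1)"
    define v where "v = real (card V)"
    \<comment> \<open>The number of coincidences guaranteed in every subset with at least half of the elements.\<close>
    define E where "E = a * (v / 2) ^ (2 * h) / real K"
    have "1 \<le> card V" using V by (simp add: Suc_le_eq card_gt_0_iff)
    then have v1: "1 \<le> v" by (simp add: v_def)
    have K1: "1 \<le> real K" using K0 by simp
    have E_eq: "E = a / 4 ^ h * v ^ (2 * h) / real K"
      by (simp add: E_def power_divide power_mult)
    have E0: "0 < E" using a v1 K0 by (simp add: E_def)
    have half: "E \<le> real (card (coincidences h U))" if U: "U \<subseteq> V" "card V \<le> 2 * card U" for U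
    proof -
      have finU: "finite U" using U V finite_subset by auto
      have vU: "v / 2 \<le> real (card U)" using U by (simp add: v_def)
      have "2 * real h ^ (2 * h) * real K \<le> c * real K / 4"
        using a K1 by (simp add: c_def field_simps)
      also have "\<dots> \<le> (v / 2)\<^sup>2" using big by (simp add: v_def power_divide)
      also have "\<dots> \<le> (real (card U))\<^sup>2" using vU v1 by (intro power_mono) auto
      finally have bigU: "2 * real h ^ (2 * h) * real K \<le> (real (card U))\<^sup>2" .
      have "(real h)\<^sup>2 \<le> real h ^ (2 * h)" using h by (intro power_increasing) auto
      also have "\<dots> = real h ^ (2 * h) * 1" by simp
      also have "\<dots> \<le> real h ^ (2 * h) * (2 * real K)" using K1 by (intro mult_left_mono) auto
      also have "\<dots> = 2 * real h ^ (2 * h) * real K" by simp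
      finally have "(real h)\<^sup>2 \<le> (real (card U))\<^sup>2" using bigU by linarith
      then have hU: "h \<le> card U" by (simp add: power2_nat_le_eq_le flip: of_nat_power)
      have KU: "card (subset_sums h U) \<le> K"
        using card_mono[OF finite_subset_sums[OF V(1)] subset_sums_mono[OF U(1)], of h] K by linarith
      have "E \<le> a * real (card U) ^ (2 * h) / real K"
        unfolding E_def using vU v1 a K1
        by (intro divide_right_mono mult_left_mono power_mono) auto
      also have "\<dots> = real (card U) ^ (2 * h) / (2 * real h ^ (2 * h) * 4 ^ h * real K)"
        by (simp add: a_def)
      also have "\<dots> \<le> real (card (coincidences h U))"
        by (rule card_coincidences_ge[OF finU h hU KU K0 bigU])
      finally show ?thesis .
    qed
    have Ev: "v \<le> 2 * real (2 * h) * E"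
    proof -
      have "4 ^ h / a * real K \<le> c * real K" using K1 h by (intro mult_right_mono) (auto simp: c_def)
      also have "\<dots> \<le> v\<^sup>2" using big by (simp add: v_def)
      also have "\<dots> \<le> v ^ (2 * h - 1)" using v1 h by (intro power_increasing) auto
      finally have "real K \<le> a / 4 ^ h * v ^ (2 * h - 1)" using a by (simp add: field_simps)
      then have "v * real K \<le> v * (a / 4 ^ h * v ^ (2 * h - 1))" using v1 by (intro mult_left_mono) auto
      also have "\<dots> = a / 4 ^ h * v ^ Suc (2 * h - 1)" by simp
      also have "Suc (2 * h - 1) = 2 * h" using h by simp
      finally have "v \<le> E" using K1 by (simp add: E_eq pos_le_divide_eq mult_ac)
      moreover have "1 * E \<le> 2 * real (2 * h) * E" using E0 h by (intro mult_right_mono) auto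
      ultimately show ?thesis by simp
    qed
    obtain H where H: "H \<subseteq> coincidences h V" "E \<le> real (card H)"
      and deg: "\<And>u. real (card {Z\<in>H. u \<in> Z}) \<le> 4 * real (2 * h) * E / real (card V)"
    proof (rule bounded_degree_subfamily[of V "coincidences h V" "2 * h" E])
      show "Z \<subseteq> V \<and> card Z = 2 * h" if "Z \<in> coincidences h V" for Z
        using that coincidences_subset card_coincidence[OF V(1)] by blast
      show "E \<le> real (card {Z \<in> coincidences h V. Z \<subseteq> U})" if U: "U \<subseteq> V" "card V \<le> 2 * card U" for U
      proof -
        have "card (coincidences h U) \<le> card {Z \<in> coincidences h V. Z \<subseteq> U}"
          using V coincidences_mono[OF U(1), of h] coincidences_subset[of _ h U]
          by (intro card_mono) (auto simp: finite_coincidences)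
        then show ?thesis using half[OF U] by linarith
      qed
    qed (use V h Ev that in \<open>auto simp: v_def\<close>)
    have HV: "Z \<subseteq> V" "card Z = 2 * h" if "Z \<in> H" for Z
      using that H coincidences_subset card_coincidence[OF V(1)] by blast+
    have finH: "finite H" using H V finite_coincidences finite_subset by metis
    define w where "w = (\<lambda>Z. if Z \<in> H then 1 else 0 :: real)"
    have wd: "wdeg V w T = real (card {Z\<in>H. T \<subseteq> Z})" for T
    proof -
      have "finite {f. T \<subseteq> f \<and> f \<subseteq> V}" using V by (auto intro: finite_subset[of _ "Pow V"])
      moreover have "{f. T \<subseteq> f \<and> f \<subseteq> V} \<inter> H = {Z\<in>H. T \<subseteq> Z}" using HV by auto
      ultimately show ?thesis by (simp add: wdeg_def w_def sum.If_cases)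
    qed
    have W: "wdeg V w {} = real (card H)" by (simp add: wd)
    have Wpos: "0 < wdeg V w {}" using W H(2) E0 by linarith
    have uni: "uniform_weight (2 * h) w" using HV by (auto simp: uniform_weight_def w_def)
    have Bmain: "B * (E / v) * (real b / v) ^ (j - 1) \<le> B * (wdeg V w {} / real (card V)) * (real b / real (card V)) ^ (j - 1)" for j
      using H(2) B1 v1 unfolding W v_def
      by (intro mult_right_mono mult_left_mono divide_right_mono) auto
    have "spread V (real b / real (card V)) B w"
      unfolding spread_def
    proof (intro allI impI)
      fix T assume T: "T \<subseteq> V" "T \<noteq> {}"
      have finT: "finite T" using T V finite_subset by auto
      define j where "j = card T"
      have j0: "0 < j" using T finT by (simp add: j_def card_gt_0_iff)
      have "real (card {Z\<in>H. T \<subseteq> Z}) \<le> B * (E / v) * (real b / v) ^ (j - 1)"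
      proof -
        consider "j = 1" | "2 \<le> j" "j < 2 * h" | "j = 2 * h" | "2 * h < j" using j0 by linarith
        then show ?thesis
        proof cases
          case 1
          then obtain u where u: "T = {u}" unfolding j_def using card_1_singletonE by blast
          have "real (card {Z\<in>H. T \<subseteq> Z}) \<le> 4 * real (2 * h) * E / v" using deg[of u] u by (simp add: v_def)
          also have "\<dots> = 8 * real h * (E / v)" by simp
          also have "\<dots> \<le> B * (E / v)" using B8 E0 v1 by (intro mult_right_mono) auto
          finally show ?thesis using 1 by simp
        next
          case 2
          define k where "k = 2 * h - 1 - j"
          have "card {Z\<in>H. T \<subseteq> Z} \<le> card {Z \<in> coincidences h V. T \<subseteq> Z}"
            using H V by (intro card_mono) (auto simp: finite_coincidences)
          also have "\<dots> \<le> 4 ^ h * card V ^ k"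
            unfolding k_def j_def by (rule card_coincidences_containing[OF V(1) T(1)]) (use 2 j_def in auto)
          finally have "real (card {Z\<in>H. T \<subseteq> Z}) \<le> real (4 ^ h * card V ^ k)" by (simp only: of_nat_le_iff)
          also have "\<dots> = 4 ^ h * v ^ k * 1" by (simp add: v_def)
          also have "\<dots> \<le> 4 ^ h * v ^ k * (B * (a / 16 ^ h) * (real b * v / real K) * real b ^ (j - 2))"
          proof (rule mult_left_mono)
            have "1 \<le> B * (a / 16 ^ h)" using B16 a by (simp add: field_simps)
            moreover have "real K \<le> real (b * card V)" using Kb by (simp only: of_nat_le_iff)
            then have "1 \<le> real b * v / real K" using K1 by (simp add: v_def)
            moreover have "1 \<le> real b ^ (j - 2)" using b by simp
            ultimately show "1 \<le> B * (a / 16 ^ h) * (real b * v / real K) * real b ^ (j - 2)"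
              by (metis mult_ge1_I)
          qed (use v1 in auto)
          also have "\<dots> = B * (a / 4 ^ h / real K) * real b ^ Suc (j - 2) * v ^ Suc k"
          proof -
            have "(16::real) ^ h = 4 ^ h * 4 ^ h" by (simp flip: power_mult_distrib)
            then show ?thesis by simp
          qed
          also have "\<dots> = B * (E / v) * (real b / v) ^ (j - 1)"
          proof -
            have "Suc k + j = 2 * h" "Suc (j - 2) = j - 1" "Suc (j - 1) = j" using 2 by (auto simp: k_def)
            then have "v ^ (2 * h) = v ^ Suc k * v * v ^ (j - 1)" "Suc (j - 2) = j - 1"
              by (metis mult.assoc power_Suc power_add)+
            then show ?thesis using v1 by (simp add: E_eq power_divide)
          qed
          finally show ?thesis .
        next
          case 3
          have "Z = T" if "Z \<in> H" "T \<subseteq> Z" for Z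
          proof -
            have "finite Z" using HV[OF that(1)] V finite_subset by auto
            then show ?thesis using that HV[OF that(1)] 3 card_subset_eq[of Z T] by (simp add: j_def)
          qed
          then have "{Z\<in>H. T \<subseteq> Z} \<subseteq> {T}" by auto
          then have "card {Z\<in>H. T \<subseteq> Z} \<le> card {T}" by (intro card_mono) auto
          then have "real (card {Z\<in>H. T \<subseteq> Z}) \<le> 1 * 1" by simp
          also have "\<dots> \<le> B * (a / 4 ^ h) * (real b ^ (2 * h - 1) / real K)"
          proof (rule mult_mono)
            have "(4::real) ^ h \<le> 16 ^ h" by (intro power_mono) auto
            then have "4 ^ h / a \<le> B" using B16 a by (meson divide_right_mono less_imp_le order_trans)
            then show "1 \<le> B * (a / 4 ^ h)" using a by (simp add: field_simps)
            have "real K \<le> real (b ^ (2 * h - 1))" using Kbh by (simp only: of_nat_le_iff)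
            then show "1 \<le> real b ^ (2 * h - 1) / real K" using K1 by simp
          qed (use a B1 in auto)
          also have "\<dots> = B * (E / v) * (real b / v) ^ (j - 1)"
          proof -
            have "Suc (2 * h - 1) = 2 * h" using h by simp
            then have "v ^ (2 * h) = v * v ^ (2 * h - 1)" by (metis power_Suc)
            then show ?thesis using v1 by (simp add: E_eq power_divide 3)
          qed
          finally show ?thesis .
        next
          case 4
          have "\<not> T \<subseteq> Z" if "Z \<in> H" for Z
            using HV[OF that] 4 V card_mono[of Z T] finite_subset[of Z V] by (auto simp: j_def)
          then have "{Z\<in>H. T \<subseteq> Z} = {}" by auto
          moreover have "0 \<le> B * (E / v) * (real b / v) ^ (j - 1)" using B1 E0 v1 by simp
          ultimately show ?thesis by (simp only: card.empty)
        qed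
      qed
      then show "wdeg V w T \<le> B * (wdeg V w {} / real (card V)) * (real b / real (card V)) ^ (card T - 1)"
        using Bmain[of j] unfolding wd j_def by linarith
    qed
    then have "container_cover (\<lambda>I. avoids I w) V (card V ^ (2 * h * b)) ((1 - \<eta>) * real (card V))"
      using cont V b uni Wpos by blast
    then show "container_cover (coincidence_free h) V (card V ^ (2 * h * b)) ((1 - \<eta>) * real (card V))"
    proof (rule container_cover_mono)
      fix I assume I: "I \<subseteq> V" "coincidence_free h I"
      show "avoids I w"
        unfolding avoids_def
      proof (intro allI impI)
        fix Z assume "Z \<subseteq> I"
        then have "Z \<notin> H" using I H coincidences_within[of Z h V I] by (auto simp: coincidence_free_def)
        then show "w Z = 0" by (simp add: w_def)
      qed
    qed auto
  qed
qed

text \<open>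
  Iteration of the previous lemma \<open>R\<close> times, until all containers have at most \<open>C\<close> elements.
\<close>

lemma coincidence_containers:
  assumes h: "2 \<le> h"
  shows "\<exists>\<eta> c. 0 < \<eta> \<and> \<eta> \<le> 1 \<and> 0 < c \<and> (\<forall>(G::'a::ab_group_add set) K b C R. finite G \<longrightarrow> G \<noteq> {} \<longrightarrow> 0 < b \<longrightarrow> 0 < K \<longrightarrow> 0 \<le> C \<longrightarrow>
     card (subset_sums h G) \<le> K \<longrightarrow> c * real K \<le> C\<^sup>2 \<longrightarrow> real K \<le> real b * C \<longrightarrow> K \<le> b ^ (2 * h - 1) \<longrightarrow>
     (1 - \<eta>) ^ R * real (card G) \<le> C \<longrightarrow>
     container_cover (coincidence_free h) G (card G ^ (2 * h * b * R)) C)"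
proof -
  from coincidence_containers_step[OF h, where ?'a = 'a] obtain \<eta> c where \<eta>: "0 < \<eta>" "\<eta> \<le> 1" and c: "0 < c"
    and step: "\<forall>(V::'a set) K b. finite V \<longrightarrow> V \<noteq> {} \<longrightarrow> 0 < b \<longrightarrow> 0 < K \<longrightarrow>
     card (subset_sums h V) \<le> K \<longrightarrow> c * real K \<le> (real (card V))\<^sup>2 \<longrightarrow> K \<le> b * card V \<longrightarrow> K \<le> b ^ (2 * h - 1) \<longrightarrow>
     container_cover (coincidence_free h) V (card V ^ (2 * h * b)) ((1 - \<eta>) * real (card V))"
    by (elim exE conjE)
  show ?thesis
  proof (rule exI[of _ \<eta>], rule exI[of _ c], intro conjI allI impI \<eta> c)
    fix G :: "'a set" and K b :: nat and C :: real and R :: nat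
    assume G: "finite G" "G \<noteq> {}" and b: "0 < b" and K0: "0 < K" and C0: "0 \<le> C" 
      and K: "card (subset_sums h G) \<le> K" and KC: "c * real K \<le> C\<^sup>2" and Kb: "real K \<le> real b * C"
      and Kbh: "K \<le> b ^ (2 * h - 1)" and R: "(1 - \<eta>) ^ R * real (card G) \<le> C"
    define k where "k = card G ^ (2 * h * b)"
    have cG: "1 \<le> card G" using G by (simp add: Suc_le_eq card_gt_0_iff)
    have "container_cover (coincidence_free h) V (k ^ r) C"
      if "V \<subseteq> G" "(1 - \<eta>) ^ r * real (card V) \<le> C" for V r
      using that
    proof (induction r arbitrary: V)
      case 0
      then show ?case by (intro container_cover_single[of V]) auto
    next
      case (Suc r)
      show ?case
      proof (cases "real (card V) \<le> C")
        case True
        then show ?thesis using cG by (intro container_cover_single[of V]) (auto simp: k_def)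
      next
        case False
        have V: "finite V" using Suc.prems G finite_subset by auto
        have Vne: "V \<noteq> {}" using False C0 by auto
        have 1: "card (subset_sums h V) \<le> K"
          using card_mono[OF finite_subset_sums[OF G(1)] subset_sums_mono[OF Suc.prems(1)], of h] K by linarith
        have 2: "c * real K \<le> (real (card V))\<^sup>2"
        proof -
          have "C\<^sup>2 \<le> (real (card V))\<^sup>2" using False C0 by (intro power_mono) auto
          then show ?thesis using KC by linarith
        qed
        have 3: "K \<le> b * card V"
        proof -
          have "real b * C \<le> real b * real (card V)" using False by (intro mult_left_mono) auto
          then have "real K \<le> real (b * card V)" using Kb by simp
          then show ?thesis by (simp only: of_nat_le_iff)
        qed
        have cov: "container_cover (coincidence_free h) V (card V ^ (2 * h * b)) ((1 - \<eta>) * real (card V))"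
          using step V Vne b K0 1 2 3 Kbh by blast
        have "card V ^ (2 * h * b) \<le> k"
          unfolding k_def using G Suc.prems(1) by (intro power_mono card_mono) auto
        then obtain \<C> where \<C>: "finite \<C>" "card \<C> \<le> k"
          "\<forall>D\<in>\<C>. D \<subseteq> V \<and> real (card D) \<le> (1 - \<eta>) * real (card V)"
          "\<forall>I\<subseteq>V. I \<noteq> {} \<and> coincidence_free h I \<longrightarrow> (\<exists>D\<in>\<C>. I \<subseteq> D)"
          using cov unfolding container_cover_def by (meson order_trans)
        have "container_cover (coincidence_free h) V (card \<C> * k ^ r) C"
        proof (rule container_cover_Union[where U = "\<lambda>D. D" and P = "\<lambda>_. coincidence_free h"])
          fix D assume D: "D \<in> \<C>"
          show "container_cover (coincidence_free h) D (k ^ r) C"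
          proof (rule Suc.IH)
            show "D \<subseteq> G" using D \<C> Suc.prems by blast
            have "(1 - \<eta>) ^ r * real (card D) \<le> (1 - \<eta>) ^ r * ((1 - \<eta>) * real (card V))"
              using D \<C> \<eta> by (intro mult_left_mono) auto
            also have "\<dots> \<le> C" using Suc.prems by (simp add: mult_ac)
            finally show "(1 - \<eta>) ^ r * real (card D) \<le> C" .
          qed
        qed (use \<C> in auto)
        then show ?thesis
        proof (rule container_cover_mono)
          show "card \<C> * k ^ r \<le> k ^ Suc r" using \<C> by simp
        qed auto
      qed
    qed
    from this[OF order_refl R] show "container_cover (coincidence_free h) G (card G ^ (2 * h * b * R)) C"
      by (simp only: k_def power_mult)
  qed
qed

text \<open>
  From $k^k/k! \le e^k \le 3^k$.
\<close>

lemma binomial_le_three_n_over_k_power: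
  assumes "0 < k"
  shows "real (n choose k) \<le> (3 * real n / real k) ^ k"
proof -
  have "real k ^ k / fact k \<le> exp (real k)"
  proof -
    have "(\<Sum>i\<in>{k}. real k ^ i /\<^sub>R fact i) \<le> (\<Sum>i. real k ^ i /\<^sub>R fact i)"
      by (rule sum_le_suminf[OF summable_exp_generic]) simp_all
    then show ?thesis by (simp only: exp_def sum.insert sum.empty finite.emptyI empty_iff not_False_eq_True
      add_0_right real_scaleR_def divide_inverse mult.commute)
  qed
  also have "\<dots> = exp 1 ^ k" using exp_of_nat_mult[of k "1::real"] by (simp only: mult_1_right)
  also have "\<dots> \<le> 3 ^ k" by (intro power_mono exp_le) simp
  finally have f: "real k ^ k \<le> 3 ^ k * fact k" by (simp add: pos_divide_le_eq)
  have "real ((n choose k) * fact k) \<le> real (n ^ k)" using binomial_fact_pow[of n k] by (simp only: of_nat_le_iff)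
  then have 1: "real (n choose k) * fact k \<le> real n ^ k" by simp
  have "real (n choose k) * real k ^ k \<le> real (n choose k) * (3 ^ k * fact k)"
    using f by (intro mult_left_mono) auto
  also have "\<dots> = 3 ^ k * (real (n choose k) * fact k)" by simp
  also have "\<dots> \<le> 3 ^ k * real n ^ k" using 1 by (intro mult_left_mono) auto
  finally have "real (n choose k) \<le> 3 ^ k * real n ^ k / real k ^ k"
    using assms by (subst pos_le_divide_eq) auto
  then show ?thesis by (simp add: power_divide power_mult_distrib)
qed

lemma card_covered_subsets:
  assumes G: "finite G" and m: "0 < m" and C: "0 \<le> C" and cover: "container_cover P G k C"
  shows "real (card {Q. Q \<subseteq> G \<and> card Q = m \<and> P Q}) \<le> real k * (3 * C / real m) ^ m"
proof -
  obtain \<C> where \<C>: "finite \<C>" "card \<C> \<le> k" "\<forall>D\<in>\<C>. D \<subseteq> G \<and> real (card D) \<le> C"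
    "\<forall>I\<subseteq>G. I \<noteq> {} \<and> P I \<longrightarrow> (\<exists>D\<in>\<C>. I \<subseteq> D)"
    using cover unfolding container_cover_def by (elim exE conjE)
  have finD: "finite D" if "D \<in> \<C>" for D
    using that \<C>(3) by (intro finite_subset[OF _ G]) simp
  have "{Q. Q \<subseteq> G \<and> card Q = m \<and> P Q} \<subseteq> (\<Union>D\<in>\<C>. {Q. Q \<subseteq> D \<and> card Q = m})"
  proof
    fix Q assume "Q \<in> {Q. Q \<subseteq> G \<and> card Q = m \<and> P Q}"
    then have Q: "Q \<subseteq> G" "card Q = m" "P Q" by auto
    then have "Q \<noteq> {}" using m by auto
    then show "Q \<in> (\<Union>D\<in>\<C>. {Q. Q \<subseteq> D \<and> card Q = m})" using \<C>(4) Q by blast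
  qed
  then have "card {Q. Q \<subseteq> G \<and> card Q = m \<and> P Q} \<le> card (\<Union>D\<in>\<C>. {Q. Q \<subseteq> D \<and> card Q = m})"
    using \<C>(1) finD by (intro card_mono) auto
  also have "\<dots> \<le> (\<Sum>D\<in>\<C>. card {Q. Q \<subseteq> D \<and> card Q = m})" by (rule card_UN_le[OF \<C>(1)])
  finally have "real (card {Q. Q \<subseteq> G \<and> card Q = m \<and> P Q}) \<le> (\<Sum>D\<in>\<C>. real (card {Q. Q \<subseteq> D \<and> card Q = m}))"
    unfolding of_nat_sum[symmetric] of_nat_le_iff .
  also have "\<dots> \<le> (\<Sum>D\<in>\<C>. (3 * C / real m) ^ m)"
  proof (rule sum_mono)
    fix D assume D: "D \<in> \<C>"
    have "real (card {Q. Q \<subseteq> D \<and> card Q = m}) = real (card D choose m)"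
      using finD[OF D] by (simp add: n_subsets)
    also have "\<dots> \<le> (3 * real (card D) / real m) ^ m" by (rule binomial_le_three_n_over_k_power[OF m])
    also have "\<dots> \<le> (3 * C / real m) ^ m"
      using \<C> D by (intro power_mono divide_right_mono mult_left_mono) auto
    finally show "real (card {Q. Q \<subseteq> D \<and> card Q = m}) \<le> (3 * C / real m) ^ m" .
  qed
  also have "\<dots> \<le> real k * (3 * C / real m) ^ m" using \<C> C by (simp add: mult_right_mono)
  finally show ?thesis .
qed

section \<open>Generic projections of grids\<close>

text \<open>
  Grid points are encoded as polynomials whose coefficients are their coordinates.  Then evaluation at
  real numbers is a supply of linear functionals in which generic choice is easy: a nonzero
  polynomial has only finitely many roots.
\<close>

interpretation poly_vs: vector_space "smult :: real \<Rightarrow> real poly \<Rightarrow> real poly"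
  by unfold_locales (simp_all add: smult_add_right smult_add_left)

text \<open>
  One step of Gaussian elimination: subtracting multiples of some \<open>b\<close> in \<open>B\<close> with \<open>f b \<noteq> 0\<close> projects
  the span of \<open>B\<close> onto the kernel of \<open>f\<close>.
\<close>

lemma span_kernel:
  fixes f :: "real poly \<Rightarrow> real"
  assumes add: "\<And>x y. f (x + y) = f x + f y" and smult: "\<And>c x. f (smult c x) = c * f x"
    and B: "finite B" and w: "w \<in> poly_vs.span B" "f w \<noteq> 0"
  shows "\<exists>B'. finite B' \<and> card B' < card B \<and> {u \<in> poly_vs.span B. f u = 0} \<subseteq> poly_vs.span B'"
proof -
  have f0: "f 0 = 0" using smult[of 0 0] by simp
  have "\<exists>b\<in>B. f b \<noteq> 0"
  proof (rule ccontr)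
    assume "\<not> (\<exists>b\<in>B. f b \<noteq> 0)"
    then have B0: "\<And>x. x \<in> B \<Longrightarrow> f x = 0" by blast
    have "poly_vs.subspace {x. f x = 0}"
      by (rule poly_vs.subspaceI) (simp_all add: f0 add smult)
    with w(1) have "f w = 0" by (rule poly_vs.span_induct) (simp add: B0)
    with w(2) show False by simp
  qed
  then obtain b where b: "b \<in> B" "f b \<noteq> 0" by blast
  define \<pi> where "\<pi> = (\<lambda>x. x - smult (f x / f b) b)"
  define B' where "B' = \<pi> ` (B - {b})"
  have \<pi>_add: "\<pi> (x + y) = \<pi> x + \<pi> y" for x y
    by (simp add: \<pi>_def add add_divide_distrib smult_add_left)
  have \<pi>_smult: "\<pi> (smult c x) = smult c (\<pi> x)" for c x
    by (simp add: \<pi>_def smult smult_diff_right)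
  have "\<pi> u \<in> poly_vs.span B'" if "u \<in> poly_vs.span B" for u
  proof -
    have "poly_vs.subspace {x. \<pi> x \<in> poly_vs.span B'}"
    proof (rule poly_vs.subspaceI)
      show "0 \<in> {x. \<pi> x \<in> poly_vs.span B'}" by (simp add: \<pi>_def f0 poly_vs.span_zero)
    qed (simp_all add: \<pi>_add \<pi>_smult poly_vs.span_add poly_vs.span_scale)
    with that show ?thesis
    proof (rule poly_vs.span_induct)
      fix x assume x: "x \<in> B"
      show "\<pi> x \<in> poly_vs.span B'"
      proof (cases "x = b")
        case True
        then have "\<pi> x = 0" using b by (simp add: \<pi>_def)
        then show ?thesis by (simp add: poly_vs.span_zero)
      next
        case False
        then show ?thesis using x by (intro poly_vs.span_base) (simp add: B'_def)
      qed
    qed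
  qed
  moreover have "\<pi> u = u" if "f u = 0" for u using that by (simp add: \<pi>_def)
  ultimately have "{u \<in> poly_vs.span B. f u = 0} \<subseteq> poly_vs.span B'" by force
  moreover have "card B' \<le> card (B - {b})" unfolding B'_def using B by (intro card_image_le) simp
  then have "card B' < card B" using card_Diff1_less[OF B b(1)] by (rule le_less_trans)
  moreover have "finite B'" using B by (simp add: B'_def)
  ultimately show ?thesis by (intro exI[of _ B'] conjI)
qed

text \<open>
  Evaluation at as many generic points as \<open>B\<close> has elements is injective on the span of \<open>B\<close>, for finitely
  many sets \<open>B\<close> simultaneously.  Each new point is chosen to be no root of one nonzero polynomial from each
  of the spans, so that every span loses a dimension.
\<close>

lemma generic_evaluation_points:
  assumes "finite J" "finite \<F>" "\<And>B. B \<in> \<F> \<Longrightarrow> finite B \<and> card B \<le> card J"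
  shows "\<exists>\<theta> :: 'j \<Rightarrow> real. \<forall>B\<in>\<F>. \<forall>u\<in>poly_vs.span B. (\<forall>j\<in>J. poly u (\<theta> j) = 0) \<longrightarrow> u = 0"
  using assms
proof (induction J arbitrary: \<F> rule: finite_induct)
  case empty
  have "B = {}" if "B \<in> \<F>" for B using empty.prems(2)[OF that] by auto
  then have "u = 0" if "B \<in> \<F>" "u \<in> poly_vs.span B" for B u
    using that poly_vs.span_empty by blast
  then show ?case by blast
next
  case (insert j J)
  \<comment> \<open>An arbitrary value if the span of \<open>B\<close> is trivial, that is, outside \<open>\<F>'\<close>.\<close>
  define nz where "nz = (\<lambda>B. SOME u. u \<in> poly_vs.span B \<and> u \<noteq> 0)"
  define \<F>' where "\<F>' = {B\<in>\<F>. \<exists>u\<in>poly_vs.span B. u \<noteq> 0}"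
  have nz: "nz B \<in> poly_vs.span B" "nz B \<noteq> 0" if "B \<in> \<F>'" for B
  proof -
    have "\<exists>u. u \<in> poly_vs.span B \<and> u \<noteq> 0" using that by (auto simp: \<F>'_def)
    from someI_ex[OF this] show "nz B \<in> poly_vs.span B" "nz B \<noteq> 0" by (auto simp: nz_def)
  qed
  have "finite (\<Union>B\<in>\<F>'. {x. poly (nz B) x = 0})"
    using insert.prems(1) nz by (intro finite_UN_I poly_roots_finite) (auto simp: \<F>'_def)
  then obtain x where x: "x \<notin> (\<Union>B\<in>\<F>'. {x. poly (nz B) x = 0})"
    using ex_new_if_finite[OF infinite_UNIV_char_0] by blast
  have "\<exists>B'. finite B' \<and> card B' \<le> card J \<and> {u \<in> poly_vs.span B. poly u x = 0} \<subseteq> poly_vs.span B'"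
    if B: "B \<in> \<F>" for B
  proof (cases "B \<in> \<F>'")
    case True
    have fB: "finite B" "card B \<le> Suc (card J)" using insert.prems(2)[OF B] insert.hyps by auto
    have nzx: "poly (nz B) x \<noteq> 0" using x True by blast
    have "\<exists>B'. finite B' \<and> card B' < card B \<and> {u \<in> poly_vs.span B. poly u x = 0} \<subseteq> poly_vs.span B'"
      by (rule span_kernel[where f = "\<lambda>u. poly u x" and w = "nz B"]) (simp_all add: nz(1)[OF True] fB nzx)
    then obtain B' where "finite B'" "card B' < card B" "{u \<in> poly_vs.span B. poly u x = 0} \<subseteq> poly_vs.span B'"
      by (elim exE conjE)
    then show ?thesis using fB by (intro exI[of _ B']) simp
  next
    case False
    then have "u = 0" if "u \<in> poly_vs.span B" for u using B that unfolding \<F>'_def by blast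
    then have "{u \<in> poly_vs.span B. poly u x = 0} \<subseteq> poly_vs.span {}"
      unfolding poly_vs.span_empty by blast
    then show ?thesis by (intro exI[of _ "{}"]) simp
  qed
  then have "\<forall>B\<in>\<F>. \<exists>B'. finite B' \<and> card B' \<le> card J \<and> {u \<in> poly_vs.span B. poly u x = 0} \<subseteq> poly_vs.span B'"
    by (rule ballI)
  from bchoice[OF this] obtain r where "\<forall>B\<in>\<F>. finite (r B) \<and> card (r B) \<le> card J \<and>
      {u \<in> poly_vs.span B. poly u x = 0} \<subseteq> poly_vs.span (r B)" by (elim exE)
  then have r: "\<And>B. B \<in> \<F> \<Longrightarrow> finite (r B) \<and> card (r B) \<le> card J \<and>
      {u \<in> poly_vs.span B. poly u x = 0} \<subseteq> poly_vs.span (r B)" by (rule bspec)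
  have "\<exists>\<theta> :: 'j \<Rightarrow> real. \<forall>B\<in>r ` \<F>. \<forall>u\<in>poly_vs.span B. (\<forall>j\<in>J. poly u (\<theta> j) = 0) \<longrightarrow> u = 0"
    by (rule insert.IH) (use insert.prems(1) r in auto)
  then obtain \<theta> :: "'j \<Rightarrow> real" where
    \<theta>: "\<forall>B\<in>r ` \<F>. \<forall>u\<in>poly_vs.span B. (\<forall>j\<in>J. poly u (\<theta> j) = 0) \<longrightarrow> u = 0"
    by (elim exE)
  have zero: "u = 0" if "B \<in> \<F>" "u \<in> poly_vs.span B" "\<forall>i\<in>insert j J. poly u ((\<theta>(j := x)) i) = 0" for B u
  proof -
    have "poly u x = 0" using that(3) by simp
    then have "u \<in> poly_vs.span (r B)" using r[OF that(1)] that(2) by blast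
    moreover have "\<forall>i\<in>J. poly u (\<theta> i) = 0" using that(3) insert.hyps by (auto split: if_splits)
    ultimately show ?thesis using \<theta> that(1) by blast
  qed
  show ?case
  proof (rule exI[of _ "\<theta>(j := x)"], intro ballI impI)
    fix B u
    assume "B \<in> \<F>" "u \<in> poly_vs.span B" "\<forall>i\<in>insert j J. poly u ((\<theta>(j := x)) i) = 0"
    then show "u = 0" by (rule zero)
  qed
qed

text \<open>
  The same elimination with coefficients as functionals: an element of a space of dimension \<open>k\<close> is
  determined by \<open>k\<close> suitable coordinates.
\<close>

lemma separating_coefficients:
  assumes "finite B"
  shows "\<exists>J. finite J \<and> card J \<le> card B \<and> (\<forall>u\<in>poly_vs.span B. (\<forall>j\<in>J. coeff u j = 0) \<longrightarrow> u = 0)"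
  using assms
proof (induction "card B" arbitrary: B rule: less_induct)
  case less
  show ?case
  proof (cases "\<exists>u\<in>poly_vs.span B. u \<noteq> 0")
    case False
    show ?thesis
    proof (rule exI[of _ "{}"], intro conjI ballI impI)
      show "u = 0" if "u \<in> poly_vs.span B" for u using False that by blast
    qed simp_all
  next
    case True
    then obtain u where u: "u \<in> poly_vs.span B" "u \<noteq> 0" by blast
    define j where "j = degree u"
    have j: "coeff u j \<noteq> 0" using u(2) by (simp add: j_def)
    have "\<exists>B'. finite B' \<and> card B' < card B \<and> {u \<in> poly_vs.span B. coeff u j = 0} \<subseteq> poly_vs.span B'"
      by (rule span_kernel[where f = "\<lambda>u. coeff u j" and w = u]) (simp_all add: u j less.prems)
    then obtain B' where B': "finite B'" "card B' < card B" "{u \<in> poly_vs.span B. coeff u j = 0} \<subseteq> poly_vs.span B'"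
      by (elim exE conjE)
    obtain J where J: "finite J" "card J \<le> card B'"
      "\<forall>u\<in>poly_vs.span B'. (\<forall>j\<in>J. coeff u j = 0) \<longrightarrow> u = 0"
      using less.hyps[OF B'(2,1)] by (elim exE conjE)
    have "card (insert j J) \<le> card B" using J(1,2) B'(1,2) by (simp add: card_insert_if)
    moreover have "\<forall>u\<in>poly_vs.span B. (\<forall>i\<in>insert j J. coeff u i = 0) \<longrightarrow> u = 0"
    proof (intro ballI impI)
      fix u assume "u \<in> poly_vs.span B" "\<forall>i\<in>insert j J. coeff u i = 0"
      then have "u \<in> poly_vs.span B'" "\<forall>i\<in>J. coeff u i = 0" using B'(3) by auto
      then show "u = 0" using J(3) by blast
    qed
    moreover have "finite (insert j J)" using J(1) by simp
    ultimately show ?thesis by (intro exI[of _ "insert j J"] conjI)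
  qed
qed

definition grid :: "nat \<Rightarrow> nat \<Rightarrow> (nat \<Rightarrow> nat) set" where
  "grid n D = {..<D} \<rightarrow>\<^sub>E {..<n}"

definition grid_poly :: "nat \<Rightarrow> (nat \<Rightarrow> nat) \<Rightarrow> real poly" where
  "grid_poly D a = (\<Sum>i<D. monom (real (a i)) i)"

definition evaluations :: "('d \<Rightarrow> real) \<Rightarrow> real poly \<Rightarrow> real ^ 'd" where
  "evaluations \<theta> p = (\<chi> i. poly p (\<theta> i))"

lemma coeff_grid_poly: "coeff (grid_poly D a) j = (if j < D then real (a j) else 0)"
  by (simp add: grid_poly_def coeff_sum)

lemma inj_grid_poly: "inj_on (grid_poly D) (grid n D)"
proof (rule inj_onI)
  fix a b assume a: "a \<in> grid n D" and b: "b \<in> grid n D" and eq: "grid_poly D a = grid_poly D b"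
  show "a = b"
  proof (rule PiE_ext)
    show "a \<in> {..<D} \<rightarrow>\<^sub>E {..<n}" "b \<in> {..<D} \<rightarrow>\<^sub>E {..<n}" using a b by (simp_all add: grid_def)
    fix i assume "i \<in> {..<D}"
    then show "a i = b i" using arg_cong[OF eq, of "\<lambda>p. coeff p i"] by (simp add: coeff_grid_poly)
  qed
qed

lemma finite_grid: "finite (grid n D)" and card_grid: "card (grid n D) = n ^ D"
  by (simp_all add: grid_def finite_PiE card_PiE)

lemma evaluations_hom: "module_hom smult scaleR (evaluations \<theta> :: real poly \<Rightarrow> real ^ 'd::finite)"
  by unfold_locales (simp_all add: evaluations_def vec_eq_iff algebra_simps)

text \<open>
  The differences of grid points on \<open>H\<close> span a space of dimension less than \<open>d\<close>: evaluation is
  injective on the span of \<open>d\<close> independent differences, so their images would be a basis of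
  $\mathbb{R}^d$ orthogonal to the normal vector of \<open>H\<close>.  Hence fewer than \<open>d\<close> coordinates, with \<open>n\<close>
  values each, determine the points on \<open>H\<close>.
\<close>

lemma hyperplane_section_of_grid:
  fixes \<theta> :: "'d::finite \<Rightarrow> real"
  assumes n: "0 < n"
    and generic: "\<And>B u. B \<subseteq> {p - q | p q. p \<in> grid_poly D ` grid n D \<and> q \<in> grid_poly D ` grid n D} \<Longrightarrow>
      card B \<le> CARD('d) \<Longrightarrow> u \<in> poly_vs.span B \<Longrightarrow> (\<And>i. poly u (\<theta> i) = 0) \<Longrightarrow> u = 0"
    and H: "hyperplane (H :: (real ^ 'd) set)"
  shows "card {p \<in> grid_poly D ` grid n D. evaluations \<theta> p \<in> H} \<le> n ^ (CARD('d) - 1)"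
proof -
  define \<P> where "\<P> = grid_poly D ` grid n D"
  define A where "A = {p \<in> \<P>. evaluations \<theta> p \<in> H}"
  have finP: "finite \<P>" by (simp add: \<P>_def finite_grid)
  then have finA: "finite A" by (simp add: A_def)
  obtain c b where c: "c \<noteq> 0" and Hc: "H = {x. c \<bullet> x = b}" using H by (auto simp: hyperplane_def)
  interpret \<phi>: module_hom "smult :: real \<Rightarrow> _" scaleR "evaluations \<theta> :: real poly \<Rightarrow> real ^ 'd"
    by (rule evaluations_hom)
  show ?thesis
  proof (cases "A = {}")
    case True
    then have "card A = 0" by simp
    then show ?thesis unfolding A_def \<P>_def by simp
  next
    case False
    then obtain p0 where p0: "p0 \<in> A" by blast
    define T where "T = (\<lambda>p. p - p0) ` A"
    obtain B where B: "B \<subseteq> T" "poly_vs.independent B" "T \<subseteq> poly_vs.span B"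
      using poly_vs.maximal_independent_subset[of T] by blast
    have finB: "finite B" using B(1) finA by (intro finite_subset[OF B(1)]) (simp add: T_def)
    have orth: "c \<bullet> evaluations \<theta> u = 0" if "u \<in> T" for u
      using that p0 by (auto simp: T_def A_def Hc \<phi>.diff inner_diff_right)
    have "card B < CARD('d)"
    proof (rule ccontr)
      assume "\<not> card B < CARD('d)"
      then obtain B0 where B0: "B0 \<subseteq> B" "card B0 = CARD('d)"
        by (meson obtain_subset_with_card_n not_le)
      have B0T: "B0 \<subseteq> T" using B0(1) B(1) by (rule order_trans)
      have "u = 0" if "u \<in> poly_vs.span B0" "evaluations \<theta> u = 0" for u
      proof (rule generic[of B0])
        show "B0 \<subseteq> {p - q | p q. p \<in> grid_poly D ` grid n D \<and> q \<in> grid_poly D ` grid n D}"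
        proof
          fix u assume "u \<in> B0"
          then obtain p where "p \<in> A" "u = p - p0" using B0T by (auto simp: T_def)
          then show "u \<in> {p - q | p q. p \<in> grid_poly D ` grid n D \<and> q \<in> grid_poly D ` grid n D}"
            using p0 unfolding A_def \<P>_def by blast
        qed
        show "poly u (\<theta> i) = 0" for i using that(2) by (simp add: evaluations_def vec_eq_iff)
      qed (simp_all add: that(1) B0(2))
      then have inj: "inj_on (evaluations \<theta>) (poly_vs.span B0)"
        unfolding \<phi>.inj_on_iff_eq_0[OF poly_vs.subspace_span] by blast
      have "poly_vs.independent B0" by (rule poly_vs.independent_mono[OF B(2) B0(1)])
      then have ind: "independent (evaluations \<theta> ` B0)"
        using \<phi>.independent_injective_image inj unfolding dependent_raw_def by blast
      have "card (evaluations \<theta> ` B0) = card B0"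
        by (intro card_image inj_on_subset[OF inj] poly_vs.span_superset)
      then have "UNIV \<subseteq> span (evaluations \<theta> ` B0)"
        using B0 by (intro card_ge_dim_independent ind) auto
      then have "c \<in> span (evaluations \<theta> ` B0)" by blast
      moreover have "subspace {x. c \<bullet> x = 0}" by (rule subspace_hyperplane)
      ultimately have "c \<bullet> c = 0"
        by (rule span_induct) (use B0T orth in blast)
      then show False using c by simp
    qed
    then have cB: "card B \<le> CARD('d) - 1" by simp
    obtain J where J: "finite J" "card J \<le> card B"
      "\<forall>u\<in>poly_vs.span B. (\<forall>j\<in>J. coeff u j = 0) \<longrightarrow> u = 0"
      using separating_coefficients[OF finB] by (elim exE conjE)
    define R where "R = (\<lambda>p :: real poly. restrict (coeff p) J)"
    have "inj_on R A"
    proof (rule inj_onI)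
      fix p q assume p: "p \<in> A" and q: "q \<in> A" and eq: "R p = R q"
      have "p - p0 \<in> poly_vs.span B" "q - p0 \<in> poly_vs.span B"
        using p q B(3) by (auto simp: T_def)
      then have "(p - p0) - (q - p0) \<in> poly_vs.span B" by (rule poly_vs.span_diff)
      then have "p - q \<in> poly_vs.span B" by simp
      moreover have "coeff (p - q) j = 0" if "j \<in> J" for j
        using fun_cong[OF eq, of j] that by (simp add: R_def)
      ultimately show "p = q" using J(3) by (metis eq_iff_diff_eq_0)
    qed
    then have "card A = card (R ` A)" by (simp add: card_image)
    also have "\<dots> \<le> card (J \<rightarrow>\<^sub>E real ` {..<n})"
    proof (rule card_mono)
      show "R ` A \<subseteq> J \<rightarrow>\<^sub>E real ` {..<n}"
        using n by (auto simp: R_def A_def \<P>_def coeff_grid_poly grid_def PiE_iff intro!: imageI)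
    qed (simp add: J finite_PiE)
    also have "\<dots> = n ^ card J" using J by (simp add: card_PiE card_image)
    also have "\<dots> \<le> n ^ (CARD('d) - 1)" using n J cB by (intro power_increasing) auto
    finally show ?thesis by (simp add: A_def \<P>_def)
  qed
qed

text \<open>
  Sums of \<open>h\<close> grid points have coordinates below \<open>h * n\<close>, and projection is linear; this bounds the
  number of sums.
\<close>

lemma projected_grid_exists:
  assumes n: "0 < n" and h: "0 < h"
  obtains G :: "(real ^ 'd::finite) set" where
    "finite G" "card G = n ^ D" "card (subset_sums h G) \<le> (h * n) ^ D"
    "\<And>H. hyperplane H \<Longrightarrow> card (G \<inter> H) \<le> n ^ (CARD('d) - 1)"
proof -
  define \<P> where "\<P> = grid_poly D ` grid n D"
  define S where "S = {p - q | p q. p \<in> \<P> \<and> q \<in> \<P>}"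
  define \<F> where "\<F> = {B. B \<subseteq> S \<and> card B \<le> CARD('d)}"
  have finP: "finite \<P>" by (simp add: \<P>_def finite_grid)
  have "S = (\<lambda>(p, q). p - q) ` (\<P> \<times> \<P>)" by (auto simp: S_def)
  then have finS: "finite S" using finP by simp
  have finF: "finite \<F>" unfolding \<F>_def by (rule finite_subset[of _ "Pow S"]) (use finS in auto)
  have bd: "finite B \<and> card B \<le> card (UNIV :: 'd set)" if "B \<in> \<F>" for B
    using that finite_subset[OF _ finS] by (simp add: \<F>_def)
  have "\<exists>\<theta> :: 'd \<Rightarrow> real. \<forall>B\<in>\<F>. \<forall>u\<in>poly_vs.span B. (\<forall>j\<in>UNIV. poly u (\<theta> j) = 0) \<longrightarrow> u = 0"
    by (rule generic_evaluation_points[OF finite_class.finite_UNIV finF bd])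
  then obtain \<theta> :: "'d \<Rightarrow> real" where
    \<theta>: "\<forall>B\<in>\<F>. \<forall>u\<in>poly_vs.span B. (\<forall>j\<in>UNIV. poly u (\<theta> j) = 0) \<longrightarrow> u = 0"
    by (elim exE)
  have gen: "u = 0" if "B \<subseteq> S" "card B \<le> CARD('d)" "u \<in> poly_vs.span B" "\<And>i. poly u (\<theta> i) = 0" for B u
    using \<theta> that unfolding \<F>_def by blast
  define \<phi> where "\<phi> = evaluations \<theta>"
  define g where "g = (\<lambda>a. \<phi> (grid_poly D a))"
  have inj\<phi>: "inj_on \<phi> \<P>"
  proof (rule inj_onI)
    fix p q assume pq: "p \<in> \<P>" "q \<in> \<P>" "\<phi> p = \<phi> q"
    have "p - q = 0"
    proof (rule gen)
      show "{p - q} \<subseteq> S" using pq by (auto simp: S_def)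
      show "p - q \<in> poly_vs.span {p - q}" by (intro poly_vs.span_base) simp
      show "poly (p - q) (\<theta> i) = 0" for i
        using pq(3) by (simp add: \<phi>_def evaluations_def vec_eq_iff)
    qed (simp add: Suc_le_eq)
    then show "p = q" by simp
  qed
  then have injg: "inj_on g (grid n D)"
    unfolding g_def using comp_inj_on[OF inj_grid_poly, of \<phi> D n] by (simp add: \<P>_def comp_def)
  define G where "G = g ` grid n D"
  have gsum: "(\<Sum>a\<in>A. g a) = g (restrict (\<lambda>j. \<Sum>a\<in>A. a j) {..<D})" for A
  proof -
    have "poly (grid_poly D b) x = (\<Sum>j<D. real (b j) * x ^ j)" for b x
      by (simp add: grid_poly_def poly_sum poly_monom)
    then have "(\<Sum>a\<in>A. poly (grid_poly D a) x) = poly (grid_poly D (restrict (\<lambda>j. \<Sum>a\<in>A. a j) {..<D})) x" for x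
      by (simp add: sum_distrib_right sum.swap[of _ A])
    then show ?thesis by (simp add: g_def \<phi>_def evaluations_def vec_eq_iff)
  qed
  have "subset_sums h G \<subseteq> g ` grid (h * n) D"
  proof
    fix x assume "x \<in> subset_sums h G"
    then obtain X where X: "X \<subseteq> G" "card X = h" "x = \<Sum>X" by (auto simp: subset_sums_def)
    obtain A where A: "A \<subseteq> grid n D" "X = g ` A" using X(1) by (auto simp: G_def subset_image_iff)
    have injA: "inj_on g A" using injg A inj_on_subset by blast
    have cA: "card A = h" using X A injA by (simp add: card_image)
    have finA: "finite A" using A finite_grid finite_subset by metis
    have "x = (\<Sum>a\<in>A. g a)" using X A injA by (simp add: sum.reindex)
    then have "x = g (restrict (\<lambda>j. \<Sum>a\<in>A. a j) {..<D})" by (simp add: gsum)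
    moreover have "(\<Sum>a\<in>A. a j) < h * n" if "j < D" for j
    proof -
      have "A \<noteq> {}" using cA h by auto
      moreover have "a j < n" if "a \<in> A" for a
        using A(1) that \<open>j < D\<close> by (auto simp: grid_def PiE_iff)
      ultimately have "(\<Sum>a\<in>A. a j) < (\<Sum>a\<in>A. n)"
        using finA by (intro sum_strict_mono) auto
      then show ?thesis using cA by simp
    qed
    then have "restrict (\<lambda>j. \<Sum>a\<in>A. a j) {..<D} \<in> grid (h * n) D" by (simp add: grid_def)
    ultimately show "x \<in> g ` grid (h * n) D" by (rule image_eqI)
  qed
  then have sums: "card (subset_sums h G) \<le> (h * n) ^ D"
    using surj_card_le[OF finite_grid, of "subset_sums h G" g "h * n" D] by (simp add: card_grid)
  have hyp: "card (G \<inter> H) \<le> n ^ (CARD('d) - 1)" if H: "hyperplane H" for H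
  proof -
    have "G \<inter> H \<subseteq> \<phi> ` {p \<in> \<P>. \<phi> p \<in> H}" by (auto simp: G_def g_def \<P>_def)
    then have "card (G \<inter> H) \<le> card {p \<in> \<P>. \<phi> p \<in> H}" using finP by (intro surj_card_le) auto
    also have "\<dots> \<le> n ^ (CARD('d) - 1)"
      unfolding \<phi>_def \<P>_def
      by (rule hyperplane_section_of_grid[OF n _ H]) (use gen in \<open>auto simp: S_def \<P>_def\<close>)
    finally show ?thesis .
  qed
  show ?thesis
  proof (rule that[of G])
    show "card G = n ^ D" unfolding G_def using injg by (simp add: card_image card_grid)
  qed (use sums hyp in \<open>auto simp: G_def finite_grid\<close>)
qed

section \<open>Random subsets and points on hyperplanes\<close>

text \<open>
  A fixed \<open>t\<close>-set is contained in a random \<open>r\<close>-subset of an \<open>M\<close>-set with probability at most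
  $(r/M)^t$.
\<close>

lemma binomial_diff_le:
  assumes "t \<le> r" "r \<le> M"
  shows "(M - t choose (r - t)) * M ^ t \<le> r ^ t * (M choose r)"
  using assms(1)
proof (induction t)
  case (Suc t)
  define X where "X = (M - t choose (r - t))"
  define X' where "X' = (M - Suc t choose (r - Suc t))"
  have tr: "t < r" using Suc.prems by simp
  have *: "(r - t) * X = (M - t) * X'"
    using binomial_absorption[of "r - Suc t" "M - t"] tr assms by (simp add: X_def X'_def Suc_diff_Suc)
  have "(M - t) * (X' * M) = (r - t) * M * X" using * by (simp add: mult_ac)
  also have "\<dots> \<le> r * (M - t) * X"
    using assms by (intro mult_right_mono) (simp_all add: diff_mult_distrib diff_mult_distrib2 diff_le_mono2)
  finally have "(M - t) * (X' * M) \<le> (M - t) * (r * X)" by (simp add: mult_ac)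
  moreover have "0 < M - t" using tr assms by simp
  ultimately have step: "X' * M \<le> r * X" by simp
  have "X' * M ^ Suc t = (X' * M) * M ^ t" by simp
  also have "\<dots> \<le> (r * X) * M ^ t" using step by (rule mult_right_mono) simp
  also have "\<dots> = r * (X * M ^ t)" by simp
  also have "\<dots> \<le> r * (r ^ t * (M choose r))" using Suc by (intro mult_left_mono) (simp_all add: X_def)
  finally show ?case by (simp add: X'_def mult_ac)
qed simp

lemma card_supersets:
  assumes "finite G" "T \<subseteq> G" "card T \<le> r"
  shows "card {W. W \<subseteq> G \<and> card W = r \<and> T \<subseteq> W} = (card G - card T choose (r - card T))"
proof -
  have fT: "finite T" using assms(1,2) by (rule finite_subset[rotated])
  have "bij_betw (\<lambda>U. U \<union> T) {U. U \<subseteq> G - T \<and> card U = r - card T} {W. W \<subseteq> G \<and> card W = r \<and> T \<subseteq> W}"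
  proof (rule bij_betw_byWitness[where f' = "\<lambda>W. W - T"])
    show "(\<lambda>U. U \<union> T) ` {U. U \<subseteq> G - T \<and> card U = r - card T} \<subseteq> {W. W \<subseteq> G \<and> card W = r \<and> T \<subseteq> W}"
    proof clarsimp
      fix U assume U: "U \<subseteq> G - T" "card U = r - card T"
      then have "finite U" using assms(1) by (meson finite_Diff finite_subset)
      then have "card (U \<union> T) = card U + card T" using U fT by (intro card_Un_disjoint) auto
      then show "U \<subseteq> G \<and> T \<subseteq> G \<and> card (U \<union> T) = r" using U assms by auto
    qed
    show "(\<lambda>W. W - T) ` {W. W \<subseteq> G \<and> card W = r \<and> T \<subseteq> W} \<subseteq> {U. U \<subseteq> G - T \<and> card U = r - card T}"
      using fT by (auto simp: card_Diff_subset)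
  qed auto
  then have "card {W. W \<subseteq> G \<and> card W = r \<and> T \<subseteq> W} = card {U. U \<subseteq> G - T \<and> card U = r - card T}"
    by (simp add: bij_betw_same_card)
  also have "\<dots> = (card (G - T) choose (r - card T))" using assms by (simp add: n_subsets)
  also have "card (G - T) = card G - card T" using assms fT by (simp add: card_Diff_subset)
  finally show ?thesis .
qed

lemma sum_card_contained_le:
  assumes G: "finite G" and r: "r \<le> card G" and T: "\<And>T. T \<in> \<T> \<Longrightarrow> T \<subseteq> G \<and> card T = t"
  shows "(\<Sum>W | W \<subseteq> G \<and> card W = r. real (card {T\<in>\<T>. T \<subseteq> W}))
    \<le> real (card \<T>) * (real r / real (card G)) ^ t * real (card G choose r)"
proof -
  have finT: "finite \<T>" by (rule finite_subset[of _ "Pow G"]) (use T G in auto)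
  have "(\<Sum>W | W \<subseteq> G \<and> card W = r. real (card {T\<in>\<T>. T \<subseteq> W}))
      = (\<Sum>W\<in>{W. W \<subseteq> G \<and> card W = r}. \<Sum>T | T \<in> \<T> \<and> T \<subseteq> W. 1)" by simp
  also have "\<dots> = (\<Sum>T\<in>\<T>. \<Sum>W | W \<in> {W. W \<subseteq> G \<and> card W = r} \<and> T \<subseteq> W. 1)"
    by (rule sum.swap_restrict) (use G finT in simp_all)
  also have "\<dots> \<le> (\<Sum>T\<in>\<T>. (real r / real (card G)) ^ t * real (card G choose r))"
  proof (rule sum_mono)
    fix T assume "T \<in> \<T>"
    then have TG: "T \<subseteq> G" "card T = t" using T by auto
    have fin: "finite {W. W \<subseteq> G \<and> card W = r \<and> T \<subseteq> W}" using G by simp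
    have "real (card {W. W \<subseteq> G \<and> card W = r \<and> T \<subseteq> W}) \<le> (real r / real (card G)) ^ t * real (card G choose r)"
    proof (cases "t \<le> r")
      case True
      show ?thesis
      proof (cases "card G = 0")
        case False
        have "real ((card G - t choose (r - t)) * card G ^ t) \<le> real (r ^ t * (card G choose r))"
          unfolding of_nat_le_iff by (rule binomial_diff_le[OF True r])
        then show ?thesis
          using False TG True card_supersets[OF G TG(1), of r] by (simp add: power_divide field_simps)
      next
        case True
        then have "G = {}" using G by simp
        then have "{W. W \<subseteq> G \<and> card W = r \<and> T \<subseteq> W} = {{}}" "t = 0" using TG r True by auto
        then show ?thesis using True r by simp
      qed
    next
      case False
      have "{W. W \<subseteq> G \<and> card W = r \<and> T \<subseteq> W} = {}"
        using False TG G card_mono[of _ T] by (force dest: finite_subset)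
      then have "card {W. W \<subseteq> G \<and> card W = r \<and> T \<subseteq> W} = 0" by (simp only: card.empty)
      then show ?thesis by simp
    qed
    then show "(\<Sum>W | W \<in> {W. W \<subseteq> G \<and> card W = r} \<and> T \<subseteq> W. 1) \<le> (real r / real (card G)) ^ t * real (card G choose r)"
      by (simp add: conj_assoc)
  qed
  also have "\<dots> = real (card \<T>) * (real r / real (card G)) ^ t * real (card G choose r)" by simp
  finally show ?thesis .
qed

text \<open>
  A random \<open>2 * N\<close>-subset contains on average at most \<open>N / 2\<close> members of \<open>\<B>\<close> and at most \<open>1 / 4\<close>
  members of \<open>\<F>\<close>.  So some subset contains fewer than \<open>N\<close> members of \<open>\<B>\<close> and none of \<open>\<F>\<close>, and
  deleting a point from each of the former leaves at least \<open>N\<close> points.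
\<close>

lemma subset_avoiding_families:
  assumes G: "finite G" and N: "0 < N" "2 * N \<le> card G"
    and B: "\<And>T. T \<in> \<B> \<Longrightarrow> T \<subseteq> G \<and> card T = t" and t: "0 < t"
    and F: "\<And>T. T \<in> \<F> \<Longrightarrow> T \<subseteq> G \<and> card T = m"
    and fewB: "real (card \<B>) * (real (2 * N) / real (card G)) ^ t \<le> real N / 2"
    and fewF: "real (card \<F>) * (real (2 * N) / real (card G)) ^ m \<le> 1 / 4"
  obtains P where "P \<subseteq> G" "card P = N" "\<And>T. T \<in> \<B> \<Longrightarrow> \<not> T \<subseteq> P" "\<And>T. T \<in> \<F> \<Longrightarrow> \<not> T \<subseteq> P"
proof -
  define \<W> where "\<W> = {W. W \<subseteq> G \<and> card W = 2 * N}"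
  define \<beta> where "\<beta> = (\<lambda>W. real (card {T\<in>\<B>. T \<subseteq> W}))"
  define \<phi> where "\<phi> = (\<lambda>W. real (card {T\<in>\<F>. T \<subseteq> W}))"
  define w where "w = real (card G choose (2 * N))"
  have cardW: "real (card \<W>) = w" using G by (simp add: \<W>_def w_def n_subsets)
  have w: "0 < w" using N by (simp add: w_def zero_less_binomial)
  have "(\<Sum>W\<in>\<W>. \<beta> W) \<le> real (card \<B>) * (real (2 * N) / real (card G)) ^ t * w"
    unfolding \<W>_def \<beta>_def w_def by (rule sum_card_contained_le[OF G N(2) B])
  also have "\<dots> \<le> real N / 2 * w" using fewB w by (intro mult_right_mono) auto
  finally have sB: "(\<Sum>W\<in>\<W>. \<beta> W) \<le> real N / 2 * w" .
  have "(\<Sum>W\<in>\<W>. \<phi> W) \<le> real (card \<F>) * (real (2 * N) / real (card G)) ^ m * w"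
    unfolding \<W>_def \<phi>_def w_def by (rule sum_card_contained_le[OF G N(2) F])
  also have "\<dots> \<le> 1 / 4 * w" using fewF w by (intro mult_right_mono) auto
  finally have sF: "(\<Sum>W\<in>\<W>. \<phi> W) \<le> 1 / 4 * w" .
  have "\<exists>W\<in>\<W>. \<beta> W / real N + \<phi> W < 1"
  proof (rule ccontr)
    assume "\<not> (\<exists>W\<in>\<W>. \<beta> W / real N + \<phi> W < 1)"
    then have "(\<Sum>W\<in>\<W>. 1) \<le> (\<Sum>W\<in>\<W>. \<beta> W / real N + \<phi> W)" by (intro sum_mono) (auto simp: not_less)
    also have "\<dots> = (\<Sum>W\<in>\<W>. \<beta> W) / real N + (\<Sum>W\<in>\<W>. \<phi> W)"
      by (simp add: sum.distrib sum_divide_distrib)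
    also have "\<dots> \<le> (real N / 2 * w) / real N + 1 / 4 * w"
      using sB sF by (intro add_mono divide_right_mono) auto
    also have "\<dots> = 3 / 4 * w" using N by simp
    finally show False using cardW w by simp
  qed
  then obtain W where W: "W \<subseteq> G" "card W = 2 * N" and less: "\<beta> W / real N + \<phi> W < 1"
    by (auto simp: \<W>_def)
  have nn: "0 \<le> \<beta> W / real N" "0 \<le> \<phi> W" by (auto simp: \<beta>_def \<phi>_def)
  have finW: "finite W" using W(1) G by (rule finite_subset)
  define BW where "BW = {T\<in>\<B>. T \<subseteq> W}"
  define FW where "FW = {T\<in>\<F>. T \<subseteq> W}"
  have fin: "finite BW" "finite FW"
    unfolding BW_def FW_def using finW by (auto intro: finite_subset[of _ "Pow W"])
  have "\<phi> W < 1" using less nn by linarith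
  then have FW: "FW = {}" using fin by (simp add: \<phi>_def FW_def[symmetric])
  have "\<beta> W / real N < 1" using less nn by linarith
  then have BW: "card BW < N" using N by (simp add: \<beta>_def BW_def[symmetric])
  define pick where "pick = (\<lambda>T. SOME x. x \<in> (T :: 'a set))"
  have pick: "pick T \<in> T" if "T \<in> BW" for T
  proof -
    have "card T = t" using that B by (simp add: BW_def)
    then have "T \<noteq> {}" using t by auto
    then show ?thesis unfolding pick_def by (simp add: some_in_eq)
  qed
  have "card (pick ` BW) \<le> card BW" by (rule card_image_le[OF fin(1)])
  moreover have "card W - card (pick ` BW) \<le> card (W - pick ` BW)"
    using fin by (intro diff_card_le_card_Diff) simp
  ultimately have "N \<le> card (W - pick ` BW)" using BW W(2) by linarith
  then obtain P where P: "P \<subseteq> W - pick ` BW" "card P = N"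
    by (meson obtain_subset_with_card_n)
  show ?thesis
  proof (rule that[of P])
    show "P \<subseteq> G" using P W by blast
    show "\<not> T \<subseteq> P" if "T \<in> \<B>" for T
    proof
      assume "T \<subseteq> P"
      then have "T \<in> BW" using that P by (auto simp: BW_def)
      then show False using pick[of T] \<open>T \<subseteq> P\<close> P by blast
    qed
    show "\<not> T \<subseteq> P" if "T \<in> \<F>" for T
    proof
      assume "T \<subseteq> P"
      then have "T \<in> FW" using that P by (auto simp: FW_def)
      then show False using FW by simp
    qed
  qed (rule P)
qed

lemma few_points_in_hyperplane:
  fixes B :: "(real ^ 'd::finite) set"
  assumes "aff_dim B < int (CARD('d))"
  obtains H where "hyperplane H" "B \<subseteq> H"
proof -
  have "aff_dim B < int (DIM(real ^ 'd))" using assms by simp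
  then obtain a b where "a \<noteq> 0" "B \<subseteq> {x. a \<bullet> x = b}" by (rule aff_lowdim_subset_hyperplane)
  then show ?thesis using that[of "{x. a \<bullet> x = b}"] unfolding hyperplane_def by blast
qed

text \<open>
  A coplanar set \<open>T\<close> has \<open>d\<close> points with the same affine hull.  Any hyperplane through these points
  contains \<open>T\<close>, so it may be chosen as a function of them, and each of the other \<open>s\<close> points is one of at most \<open>L\<close>.
\<close>

lemma card_coplanar_le:
  fixes G :: "(real ^ 'd::finite) set"
  assumes G: "finite G" and L: "\<And>H. hyperplane H \<Longrightarrow> card (G \<inter> H) \<le> L"
  shows "card {T. T \<subseteq> G \<and> card T = CARD('d) + s \<and> (\<exists>H. hyperplane H \<and> T \<subseteq> H)} \<le> card G ^ CARD('d) * L ^ s"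
proof -
  define d where "d = CARD('d)"
  \<comment> \<open>Any \<open>d\<close> points lie on some hyperplane; one is fixed for each \<open>d\<close>-set.\<close>
  define Hp where "Hp = (\<lambda>B. SOME H. hyperplane H \<and> B \<subseteq> (H :: (real ^ 'd) set))"
  have Hp: "hyperplane (Hp B)" "B \<subseteq> Hp B" if B: "B \<subseteq> G" "card B = d" for B
  proof -
    have "finite B" using B(1) G by (rule finite_subset)
    then have "aff_dim B < int (CARD('d))" using aff_dim_le_card[of B] B by (simp add: d_def)
    then obtain H where "hyperplane H \<and> B \<subseteq> H" by (meson few_points_in_hyperplane)
    then have "hyperplane (Hp B) \<and> B \<subseteq> Hp B" unfolding Hp_def by (rule someI)
    then show "hyperplane (Hp B)" "B \<subseteq> Hp B" by auto
  qed
  define \<B> where "\<B> = {B. B \<subseteq> G \<and> card B = d}"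
  have fB: "finite \<B>" using G by (simp add: \<B>_def)
  have "{T. T \<subseteq> G \<and> card T = d + s \<and> (\<exists>H. hyperplane H \<and> T \<subseteq> H)}
      \<subseteq> (\<Union>B\<in>\<B>. (\<lambda>U. B \<union> U) ` {U. U \<subseteq> G \<inter> Hp B \<and> card U = s})"
  proof
    fix T assume "T \<in> {T. T \<subseteq> G \<and> card T = d + s \<and> (\<exists>H. hyperplane H \<and> T \<subseteq> H)}"
    then obtain H where T: "T \<subseteq> G" "card T = d + s" "hyperplane H" "T \<subseteq> H" by blast
    have finT: "finite T" using T(1) G by (rule finite_subset)
    obtain a b where ab: "a \<noteq> 0" "H = {x. a \<bullet> x = b}" using T(3) by (auto simp: hyperplane_def)
    have "aff_dim T \<le> aff_dim H" using T(4) by (rule aff_dim_subset)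
    also have "\<dots> = int d - 1" unfolding ab(2) using ab(1) by (simp add: aff_dim_hyperplane d_def)
    finally have dimT: "aff_dim T \<le> int d - 1" .
    obtain B0 where B0: "B0 \<subseteq> T" "\<not> affine_dependent B0" "affine hull T = affine hull B0"
      using affine_basis_exists[of T] by blast
    have "aff_dim B0 = aff_dim T" using B0(3) by (metis aff_dim_affine_hull)
    then have "card B0 \<le> d" using dimT B0(2) by (simp add: affine_independent_iff_card)
    then obtain B where B: "B0 \<subseteq> B" "B \<subseteq> T" "card B = d"
      using exists_subset_between[of B0 d T] B0(1) T(2) finT by auto
    have BG: "B \<subseteq> G" using B(2) T(1) by (rule order_trans)
    have finB: "finite B" using BG G by (rule finite_subset)
    have "affine (Hp B)" using Hp(1)[OF BG B(3)] by (auto simp: hyperplane_def affine_hyperplane)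
    then have "affine hull B \<subseteq> Hp B" using Hp(2)[OF BG B(3)] by (intro hull_minimal)
    moreover have "T \<subseteq> affine hull B"
      using hull_subset[of T affine] hull_mono[OF B(1), of affine] B0(3) by blast
    ultimately have "T - B \<subseteq> G \<inter> Hp B" using T(1) by blast
    moreover have "card (T - B) = s" using B T(2) finB by (simp add: card_Diff_subset)
    moreover have "T = B \<union> (T - B)" using B(2) by blast
    moreover have "B \<in> \<B>" using BG B(3) by (simp add: \<B>_def)
    ultimately show "T \<in> (\<Union>B\<in>\<B>. (\<lambda>U. B \<union> U) ` {U. U \<subseteq> G \<inter> Hp B \<and> card U = s})" by blast
  qed
  then have "card {T. T \<subseteq> G \<and> card T = d + s \<and> (\<exists>H. hyperplane H \<and> T \<subseteq> H)}
      \<le> card (\<Union>B\<in>\<B>. (\<lambda>U. B \<union> U) ` {U. U \<subseteq> G \<inter> Hp B \<and> card U = s})"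
    using fB G by (intro card_mono) auto
  also have "\<dots> \<le> (\<Sum>B\<in>\<B>. card ((\<lambda>U. B \<union> U) ` {U. U \<subseteq> G \<inter> Hp B \<and> card U = s}))"
    by (rule card_UN_le[OF fB])
  also have "\<dots> \<le> (\<Sum>B\<in>\<B>. L ^ s)"
  proof (rule sum_mono)
    fix B assume "B \<in> \<B>"
    then have B: "B \<subseteq> G" "card B = d" by (auto simp: \<B>_def)
    have "card ((\<lambda>U. B \<union> U) ` {U. U \<subseteq> G \<inter> Hp B \<and> card U = s}) \<le> card {U. U \<subseteq> G \<inter> Hp B \<and> card U = s}"
      using G by (intro card_image_le) simp
    also have "\<dots> \<le> card (G \<inter> Hp B) ^ s" using G by (intro card_subsets_le_power) simp
    also have "\<dots> \<le> L ^ s" using L[OF Hp(1)[OF B]] by (intro power_mono) auto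
    finally show "card ((\<lambda>U. B \<union> U) ` {U. U \<subseteq> G \<inter> Hp B \<and> card U = s}) \<le> L ^ s" .
  qed
  also have "\<dots> = card \<B> * L ^ s" by simp
  also have "\<dots> \<le> card G ^ d * L ^ s"
    unfolding \<B>_def using G by (intro mult_right_mono card_subsets_le_power) auto
  finally show ?thesis by (simp add: d_def)
qed

text \<open>
  The coefficients are $1$ on one side of the equation and $-1$ on the other.
\<close>

lemma coincidence_affine_dependent:
  fixes Z :: "'a::euclidean_space set"
  assumes "Z \<in> coincidences h V" "0 < h"
  shows "affine_dependent Z"
proof -
  obtain X Y where XY: "Z = X \<union> Y" "X \<inter> Y = {}" "card X = h" "card Y = h" "\<Sum>X = \<Sum>Y"
    using assms(1) by (rule coincidencesE)
  have fin: "finite X" "finite Y" using XY assms(2) by (auto intro: card_ge_0_finite)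
  have "X \<noteq> {}" using XY assms(2) by auto
  then obtain x where x: "x \<in> X" by blast
  define u where "u = (\<lambda>z. if z \<in> X then 1 else -1 :: real)"
  have notX: "y \<in> Y \<Longrightarrow> y \<notin> X" for y using XY(2) by blast
  have "sum u Z = sum u X + sum u Y" unfolding XY(1) using fin XY(2) by (rule sum.union_disjoint)
  also have "\<dots> = 0" using XY by (simp add: u_def notX)
  finally have "sum u Z = 0" .
  moreover have "(\<Sum>z\<in>Z. u z *\<^sub>R z) = (\<Sum>z\<in>X. u z *\<^sub>R z) + (\<Sum>z\<in>Y. u z *\<^sub>R z)"
    unfolding XY(1) using fin XY(2) by (rule sum.union_disjoint)
  then have "(\<Sum>z\<in>Z. u z *\<^sub>R z) = 0" using XY(5) by (simp add: u_def notX sum_negf)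
  moreover have "x \<in> Z" "u x \<noteq> 0" using x XY by (auto simp: u_def)
  moreover have "finite Z" using fin XY by simp
  ultimately show ?thesis using affine_dependent_explicit_finite by blast
qed

lemma general_position_coincidence_free:
  fixes Q :: "(real ^ 'd::finite) set"
  assumes gp: "general_position Q" and Q: "CARD('d) + 1 \<le> card Q" and h: "0 < h" "2 * h \<le> CARD('d) + 1"
  shows "coincidence_free h Q"
proof (rule ccontr)
  assume "\<not> coincidence_free h Q"
  then obtain Z where Z: "Z \<in> coincidences h Q" by (auto simp: coincidence_free_def)
  have finQ: "finite Q" using gp by (simp add: general_position_def)
  have ZQ: "Z \<subseteq> Q" using Z by (rule coincidences_subset)
  have "card Z \<le> CARD('d) + 1" using card_coincidence[OF finQ Z] h by simp
  then obtain T where T: "Z \<subseteq> T" "T \<subseteq> Q" "card T = CARD('d) + 1"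
    using exists_subset_between[of Z "CARD('d) + 1" Q] Q ZQ finQ by auto
  have finT: "finite T" using T(2) finQ by (rule finite_subset)
  have "affine_dependent T"
    using coincidence_affine_dependent[OF Z h(1)] T(1) by (rule affine_dependent_subset)
  then have "aff_dim T \<noteq> int (card T) - 1" using finT affine_independent_iff_card[of T] by blast
  then have "aff_dim T < int (CARD('d))" using aff_dim_le_card[OF finT] T(3) by simp
  then obtain H where "hyperplane H" "T \<subseteq> H" by (rule few_points_in_hyperplane)
  then show False using gp T finT unfolding general_position_def no_members_on_hyperplane_def by blast
qed

section \<open>Choice of the parameters\<close>

text \<open>
  One set without large subsets in general position also shows that the maximum in the definition
  of \<open>alpha\<close> is attained.
\<close>

lemma alpha_less:
  fixes P :: "(real ^ 'd::finite) set"
  assumes P: "finite P" "card P = N" "no_members_on_hyperplane (CARD('d) + s) P"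
    and less: "\<And>Q. Q \<subseteq> P \<Longrightarrow> general_position Q \<Longrightarrow> card Q < m"
  shows "alpha TYPE('d) s N < m"
proof -
  define good where "good = (\<lambda>k. \<forall>P :: (real ^ 'd) set.
    finite P \<and> card P = N \<and> no_members_on_hyperplane (CARD('d) + s) P \<longrightarrow>
      (\<exists>Q\<subseteq>P. card Q = k \<and> general_position Q))"
  have bound: "k < m" if "good k" for k
  proof -
    from that[unfolded good_def, rule_format, of P] P
    obtain Q where "Q \<subseteq> P" "card Q = k" "general_position Q" by auto
    then show ?thesis using less[of Q] by simp
  qed
  have "general_position ({} :: (real ^ 'd) set)"
    by (auto simp: general_position_def no_members_on_hyperplane_def)
  then have "good 0" unfolding good_def by (intro allI impI exI[of _ "{}"]) simp
  then have "good (Greatest good)"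
  proof (rule GreatestI_nat)
    show "k \<le> m" if "good k" for k using bound[OF that] by simp
  qed
  then have "Greatest good < m" by (rule bound)
  then show ?thesis by (simp add: alpha_def good_def)
qed

text \<open>
  The probabilistic construction for the projection of $\{0,\dots,n-1\}^D$, with all requirements on the parameters
  collected: \<open>M\<close> is the number of points of the grid, \<open>h ^ D * M\<close> bounds the number of sums, \<open>C\<close> is
  the size of the containers and $M^{2hbR}$ their number.  The value of \<open>C\<close> makes the bound
  $2^m (3C/m)^m (2N/M)^m$ for the expected number of coincidence-free \<open>m\<close>-sets equal to $4^{-m}$.
\<close>

lemma alpha_less_of_parameters:
  assumes h: "2 \<le> h" "2 * h \<le> CARD('d::finite) + 1"
  shows "\<exists>\<eta> c. 0 < \<eta> \<and> \<eta> \<le> 1 \<and> 0 < c \<and> (\<forall>(n::nat) (D::nat) (N::nat) (m::nat) (b::nat) (R::nat) (s::nat) (M::real) (C::real).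
    M = real n ^ D \<longrightarrow> C = M * real m / (48 * real N) \<longrightarrow> 0 < n \<longrightarrow> 0 < N \<longrightarrow> 0 < b \<longrightarrow> 2 * real N \<le> M \<longrightarrow> CARD('d) < m \<longrightarrow>
    M ^ CARD('d) * (real n ^ (CARD('d) - 1)) ^ s * (2 * real N / M) ^ (CARD('d) + s) \<le> real N / 2 \<longrightarrow>
    c * (real h ^ D * M) \<le> C\<^sup>2 \<longrightarrow> real h ^ D * M \<le> real b * C \<longrightarrow> real h ^ D * M \<le> real b ^ (2 * h - 1) \<longrightarrow>
    (1 - \<eta>) ^ R * M \<le> C \<longrightarrow> M ^ (2 * h * b * R) \<le> 2 ^ m \<longrightarrow>
    alpha TYPE('d) s N < m)"
proof -
  from coincidence_containers[OF h(1), where ?'a = "real ^ 'd"] obtain \<eta> c where \<eta>: "0 < \<eta>" "\<eta> \<le> 1" and c: "0 < c"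
    and cont: "\<forall>(G::(real ^ 'd) set) K b C R. finite G \<longrightarrow> G \<noteq> {} \<longrightarrow> 0 < b \<longrightarrow> 0 < K \<longrightarrow> 0 \<le> C \<longrightarrow>
     card (subset_sums h G) \<le> K \<longrightarrow> c * real K \<le> C\<^sup>2 \<longrightarrow> real K \<le> real b * C \<longrightarrow> K \<le> b ^ (2 * h - 1) \<longrightarrow>
     (1 - \<eta>) ^ R * real (card G) \<le> C \<longrightarrow>
     container_cover (coincidence_free h) G (card G ^ (2 * h * b * R)) C"
    by (elim exE conjE)
  show ?thesis
  proof (rule exI[of _ \<eta>], rule exI[of _ c], intro conjI allI impI \<eta> c)
    fix n D N m b R s :: nat and M C :: real
    assume M: "M = real n ^ D" and C: "C = M * real m / (48 * real N)" and n: "0 < n" and N: "0 < N" and b: "0 < b"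
      and NM: "2 * real N \<le> M" and m: "CARD('d) < m"
      and few: "M ^ CARD('d) * (real n ^ (CARD('d) - 1)) ^ s * (2 * real N / M) ^ (CARD('d) + s) \<le> real N / 2"
      and c1: "c * (real h ^ D * M) \<le> C\<^sup>2" and c2: "real h ^ D * M \<le> real b * C"
      and c3: "real h ^ D * M \<le> real b ^ (2 * h - 1)" and c4: "(1 - \<eta>) ^ R * M \<le> C"
      and c5: "M ^ (2 * h * b * R) \<le> 2 ^ m"
    have h0: "0 < h" using h by simp
    have M0: "0 < M" using n by (simp add: M)
    have m0: "0 < m" using m by simp
    obtain G :: "(real ^ 'd) set" where G: "finite G" "card G = n ^ D" "card (subset_sums h G) \<le> (h * n) ^ D"
      and hyp: "\<And>H. hyperplane H \<Longrightarrow> card (G \<inter> H) \<le> n ^ (CARD('d) - 1)"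
      using projected_grid_exists[OF n h0, where ?'d = 'd and D = D] by metis
    have cG: "real (card G) = M" by (simp add: G M)
    have Gne: "G \<noteq> {}" using cG M0 by auto
    define K where "K = (h * n) ^ D"
    have K: "real K = real h ^ D * M" by (simp add: K_def M power_mult_distrib)
    have K0: "0 < K" using h n by (simp add: K_def)
    have C0: "0 \<le> C" using M0 by (simp add: C)
    have "real K \<le> real (b ^ (2 * h - 1))" using c3 by (simp add: K)
    then have Kb: "K \<le> b ^ (2 * h - 1)" by (simp only: of_nat_le_iff)
    have "container_cover (coincidence_free h) G (card G ^ (2 * h * b * R)) C"
      using cont[rule_format, OF G(1) Gne b K0 C0 G(3)[folded K_def]] c1 c2 Kb c4 by (simp add: K cG)
    define \<F> where "\<F> = {Q. Q \<subseteq> G \<and> card Q = m \<and> coincidence_free h Q}"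
    define \<B> where "\<B> = {T. T \<subseteq> G \<and> card T = CARD('d) + s \<and> (\<exists>H. hyperplane H \<and> T \<subseteq> H)}"
    have "real (card \<F>) \<le> real (card G ^ (2 * h * b * R)) * (3 * C / real m) ^ m"
      unfolding \<F>_def by (rule card_covered_subsets[OF G(1) m0 C0]) fact
    also have "\<dots> \<le> 2 ^ m * (3 * C / real m) ^ m"
      using c5 C0 by (intro mult_right_mono) (simp_all add: cG)
    finally have "real (card \<F>) * (real (2 * N) / real (card G)) ^ m \<le> 2 ^ m * (3 * C / real m) ^ m * (real (2 * N) / real (card G)) ^ m"
      by (rule mult_right_mono) simp
    also have "\<dots> = (2 * (3 * C / real m) * (2 * real N / M)) ^ m"
      by (simp only: power_mult_distrib cG of_nat_mult of_nat_numeral)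
    also have "2 * (3 * C / real m) * (2 * real N / M) = 1 / 4"
      using M0 N m0 by (simp add: C field_simps)
    also have "(1 / 4 :: real) ^ m \<le> (1 / 4) ^ 1" using m0 by (intro power_decreasing) auto
    finally have fewF: "real (card \<F>) * (real (2 * N) / real (card G)) ^ m \<le> 1 / 4" by simp
    have "card \<B> \<le> card G ^ CARD('d) * (n ^ (CARD('d) - 1)) ^ s"
      unfolding \<B>_def by (rule card_coplanar_le[OF G(1) hyp])
    then have "real (card \<B>) \<le> real (card G ^ CARD('d) * (n ^ (CARD('d) - 1)) ^ s)" by (simp only: of_nat_le_iff)
    then have "real (card \<B>) \<le> M ^ CARD('d) * (real n ^ (CARD('d) - 1)) ^ s" by (simp add: cG)
    then have "real (card \<B>) * (real (2 * N) / real (card G)) ^ (CARD('d) + s)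
        \<le> M ^ CARD('d) * (real n ^ (CARD('d) - 1)) ^ s * (2 * real N / M) ^ (CARD('d) + s)"
      using M0 by (simp only: cG of_nat_mult of_nat_numeral) (intro mult_right_mono, auto)
    then have fewB: "real (card \<B>) * (real (2 * N) / real (card G)) ^ (CARD('d) + s) \<le> real N / 2"
      using few by linarith
    have "real (2 * N) \<le> real (card G)" using NM by (simp add: cG)
    then have NG: "2 * N \<le> card G" by (simp only: of_nat_le_iff)
    obtain P where P: "P \<subseteq> G" "card P = N" and PB: "\<And>T. T \<in> \<B> \<Longrightarrow> \<not> T \<subseteq> P" and PF: "\<And>T. T \<in> \<F> \<Longrightarrow> \<not> T \<subseteq> P"
      by (rule subset_avoiding_families[OF G(1) N NG _ _ _ fewB fewF]) (auto simp: \<B>_def \<F>_def)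
    show "alpha TYPE('d) s N < m"
    proof (rule alpha_less)
      show "finite P" using P(1) G(1) by (rule finite_subset)
      show "no_members_on_hyperplane (CARD('d) + s) P"
        unfolding no_members_on_hyperplane_def
      proof clarify
        fix T H assume T: "T \<subseteq> P" "card T = CARD('d) + s" "hyperplane H" "T \<subseteq> H"
        have "T \<in> \<B>" unfolding \<B>_def using T order_trans[OF T(1) P(1)] by blast
        then show False using PB T(1) by blast
      qed
      fix Q assume Q: "Q \<subseteq> P" "general_position Q"
      show "card Q < m"
      proof (rule ccontr)
        assume "\<not> card Q < m"
        then have mQ: "m \<le> card Q" by simp
        then have free: "coincidence_free h Q"
          using m h by (intro general_position_coincidence_free[OF Q(2)]) auto
        obtain R where R: "R \<subseteq> Q" "card R = m" using obtain_subset_with_card_n[OF mQ] by blast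
        have "R \<subseteq> P" using R(1) Q(1) by (rule order_trans)
        moreover have "R \<subseteq> G" using \<open>R \<subseteq> P\<close> P(1) by (rule order_trans)
        then have "R \<in> \<F>" using R coincidence_free_subset[OF free R(1)] by (simp add: \<F>_def)
        ultimately show False using PF by blast
      qed
    qed (rule P)
  qed
qed

lemma eventually_polylog_bound:
  fixes a b c k \<delta> \<eta> :: real
  assumes "0 < \<delta>" "0 < \<eta>"
  shows "eventually (\<lambda>x. k * sqrt x * ((a + b * ln x) / \<eta> + 1) * (a + b * ln x) \<le> x powr (1 / 2 + \<delta>) * ln 2) at_top"
proof -
  have "((\<lambda>x. k * sqrt x * ((a + b * ln x) / \<eta> + 1) * (a + b * ln x) / (x powr (1 / 2 + \<delta>))) \<longlongrightarrow> 0) at_top"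
    using assms by real_asymp
  then have "eventually (\<lambda>x. k * sqrt x * ((a + b * ln x) / \<eta> + 1) * (a + b * ln x) / (x powr (1 / 2 + \<delta>)) < ln 2) at_top"
    by (rule order_tendstoD) simp
  then show ?thesis
    using eventually_gt_at_top[of "0::real"]
    by eventually_elim (simp add: pos_divide_less_eq mult.commute)
qed

lemma eventually_le_powr:
  fixes C \<delta> :: real
  assumes "0 < \<delta>"
  shows "eventually (\<lambda>x. C \<le> x powr \<delta>) at_top"
proof -
  have "filterlim (\<lambda>x. x powr \<delta>) at_top at_top" using assms by real_asymp
  then show ?thesis unfolding filterlim_at_top by (rule spec)
qed

lemma eventually_powr_le_powr:
  fixes C \<kappa> g :: real
  assumes "\<kappa> < g"
  shows "eventually (\<lambda>x. C * x powr \<kappa> \<le> x powr g) at_top"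
proof -
  have "eventually (\<lambda>x. C \<le> x powr (g - \<kappa>)) at_top"
    by (rule eventually_le_powr) (use assms in simp)
  then show ?thesis
  proof eventually_elim
    case (elim x)
    then have "C * x powr \<kappa> \<le> x powr (g - \<kappa>) * x powr \<kappa>" by (rule mult_right_mono) simp
    then show ?case by (simp flip: powr_add)
  qed
qed

text \<open>
  The dimension \<open>D\<close> is fixed and \<open>n\<close> is about $N^\rho$, the least order for which few enough $(d+s)$-tuples are
  coplanar.  Then $M = n^D$ is about $N^\kappa$, where $\kappa$ tends to $(d+s-1)/s$ as $D$ grows, and \<open>D\<close> is taken
  so large that $\kappa < (2h-1)/2$.
\<close>

lemma alpha_eventually_le:
  fixes h s :: nat and \<delta> :: real
  assumes h: "2 \<le> h" "2 * h \<le> CARD('d::finite) + 1" and s: "0 < s"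
    and cond: "2 * (CARD('d) + s - 1) < s * (2 * h - 1)" and \<delta>: "0 < \<delta>"
  shows "eventually (\<lambda>N. real (alpha TYPE('d) s N) \<le> real N powr (1 / 2 + \<delta>)) sequentially"
proof -
  define d where "d = CARD('d)"
  define \<sigma> where "\<sigma> = d + s - 1"
  define D where "D = (2 * \<sigma> + 1) * (d - 1) + 1"
  define E where "E = 2 * \<sigma> * (d - 1) + 1"
  define \<rho> where "\<rho> = real \<sigma> / (real s * real E)"
  define A :: real where "A = 2 ^ (d + s + 1)"
  define g where "g = real (2 * h - 1) / 2"
  define \<kappa> where "\<kappa> = \<rho> * real D"
  define U where "U = (2 * A) ^ D"
  have d: "0 < d" by (simp add: d_def)
  have DE: "D = E + (d - 1)" by (simp add: D_def E_def algebra_simps)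
  have E0: "0 < E" by (simp add: E_def)
  have A1: "1 \<le> A" unfolding A_def by (rule one_le_power) simp
  have U1: "1 \<le> U" unfolding U_def by (rule one_le_power) (use A1 in simp)
  have \<rho>0: "0 \<le> \<rho>" by (simp add: \<rho>_def)
  have \<rho>E: "\<rho> * real (s * E) = real \<sigma>" using s E0 by (simp add: \<rho>_def)
  have \<kappa>g: "\<kappa> < g"
  proof -
    obtain e where "D = E + e" "E = 2 * \<sigma> * e + 1" using DE E_def by blast
    then have "2 * \<sigma> * D < (2 * \<sigma> + 1) * E" by (simp add: algebra_simps)
    also have "\<dots> \<le> s * (2 * h - 1) * E" using cond by (intro mult_right_mono) (simp_all add: \<sigma>_def d_def)
    finally have "real (2 * \<sigma> * D) < real (s * (2 * h - 1) * E)" by (simp only: of_nat_less_iff)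
    then have "2 * (real \<sigma> * real D) < real (2 * h - 1) * (real s * real E)"
      by (simp only: of_nat_mult of_nat_numeral mult_ac)
    then have "2 * (real \<sigma> * real D) / (real s * real E) < real (2 * h - 1)"
      using s E0 by (subst pos_divide_less_eq) auto
    moreover have "\<kappa> = 2 * (real \<sigma> * real D) / (real s * real E) / 2" by (simp add: \<kappa>_def \<rho>_def)
    ultimately show ?thesis
      unfolding g_def by (simp only: divide_strict_right_mono zero_less_numeral)
  qed
  from alpha_less_of_parameters[OF h] obtain \<eta> c where \<eta>: "0 < \<eta>" "\<eta> \<le> 1" and c: "0 < c"
    and main: "\<forall>(n::nat) (D::nat) (N::nat) (m::nat) (b::nat) (R::nat) (s::nat) (M::real) (C::real).
    M = real n ^ D \<longrightarrow> C = M * real m / (48 * real N) \<longrightarrow> 0 < n \<longrightarrow> 0 < N \<longrightarrow> 0 < b \<longrightarrow> 2 * real N \<le> M \<longrightarrow> CARD('d) < m \<longrightarrow>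
    M ^ CARD('d) * (real n ^ (CARD('d) - 1)) ^ s * (2 * real N / M) ^ (CARD('d) + s) \<le> real N / 2 \<longrightarrow>
    c * (real h ^ D * M) \<le> C\<^sup>2 \<longrightarrow> real h ^ D * M \<le> real b * C \<longrightarrow> real h ^ D * M \<le> real b ^ (2 * h - 1) \<longrightarrow>
    (1 - \<eta>) ^ R * M \<le> C \<longrightarrow> M ^ (2 * h * b * R) \<le> 2 ^ m \<longrightarrow>
    alpha TYPE('d) s N < m"
    by (elim exE conjE)
  have \<delta>': "0 < 1 / 2 + \<delta>" "0 < 2 * \<delta>" using \<delta> by auto
  have "eventually (\<lambda>x::real. 1 \<le> x \<and> real d + 24 \<le> x powr (1 / 2 + \<delta>) \<and> 48 * real h ^ D \<le> x powr \<delta> \<and>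
      c * real h ^ D * 1152 \<le> x powr (2 * \<delta>) \<and> real h ^ D * U * x powr \<kappa> \<le> x powr g \<and>
      4 * real h * sqrt x * ((ln U + \<kappa> * ln x) / \<eta> + 1) * (ln U + \<kappa> * ln x) \<le> x powr (1 / 2 + \<delta>) * ln 2) at_top"
    by (intro eventually_conj eventually_ge_at_top eventually_le_powr eventually_powr_le_powr
        eventually_polylog_bound \<delta> \<delta>' \<eta> \<kappa>g)
  then have "eventually (\<lambda>N. 1 \<le> real N \<and> real d + 24 \<le> real N powr (1 / 2 + \<delta>) \<and> 48 * real h ^ D \<le> real N powr \<delta> \<and>
      c * real h ^ D * 1152 \<le> real N powr (2 * \<delta>) \<and> real h ^ D * U * real N powr \<kappa> \<le> real N powr g \<and>
      4 * real h * sqrt (real N) * ((ln U + \<kappa> * ln (real N)) / \<eta> + 1) * (ln U + \<kappa> * ln (real N))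
        \<le> real N powr (1 / 2 + \<delta>) * ln 2) sequentially"
    by (rule eventually_compose_filterlim[OF _ filterlim_real_sequentially])
  then show ?thesis
  proof eventually_elim
    case (elim N)
    define x where "x = real N"
    have x1: "1 \<le> x" and e1: "real d + 24 \<le> x powr (1 / 2 + \<delta>)" and e2: "48 * real h ^ D \<le> x powr \<delta>"
      and e3: "c * real h ^ D * 1152 \<le> x powr (2 * \<delta>)" and e4: "real h ^ D * U * x powr \<kappa> \<le> x powr g"
      and e5: "4 * real h * sqrt x * ((ln U + \<kappa> * ln x) / \<eta> + 1) * (ln U + \<kappa> * ln x) \<le> x powr (1 / 2 + \<delta>) * ln 2"
      using elim by (auto simp: x_def)
    define n where "n = nat \<lceil>A * x powr \<rho>\<rceil>"
    define b where "b = nat \<lceil>sqrt x\<rceil>"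
    define m where "m = nat \<lceil>x powr (1 / 2 + \<delta>)\<rceil>"
    define M where "M = real n ^ D"
    define C where "C = M * real m / (48 * real N)"
    \<comment> \<open>Enough iterations for $(1-\eta)^R \le 1/M$.\<close>
    define R where "R = nat \<lceil>ln M / \<eta>\<rceil>"
    have x0: "0 < x" using x1 by simp
    have xr: "1 \<le> x powr \<rho>" using x1 \<rho>0 by (rule ge_one_powr_ge_zero)
    have "1 * 1 \<le> A * x powr \<rho>" using A1 xr by (intro mult_mono) auto
    then have Axr: "1 \<le> A * x powr \<rho>" by simp
    have n_ge: "A * x powr \<rho> \<le> real n" unfolding n_def by linarith
    have "real n \<le> A * x powr \<rho> + 1" unfolding n_def using Axr by linarith
    then have n_le: "real n \<le> 2 * A * x powr \<rho>" using Axr by linarith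
    have n0: "0 < n" using n_ge Axr by linarith
    have b_ge: "sqrt x \<le> real b" unfolding b_def by linarith
    have sx: "1 \<le> sqrt x" using x1 by simp
    have b_le: "real b \<le> 2 * sqrt x" unfolding b_def using sx by linarith
    have b0: "0 < b" using b_ge sx by linarith
    have m_ge: "x powr (1 / 2 + \<delta>) \<le> real m" unfolding m_def by linarith
    have powrk: "(x powr \<rho>) ^ k = x powr (\<rho> * real k)" for k
      using x0 powr_realpow[of "x powr \<rho>" k] by (simp add: powr_powr)
    have nsE: "A * x ^ \<sigma> \<le> real n ^ (s * E)"
    proof -
      have "A * x ^ \<sigma> = A ^ 1 * x powr real \<sigma>" using x0 by (simp add: powr_realpow)
      also have "\<dots> \<le> A ^ (s * E) * x powr real \<sigma>"
        using A1 s E0 by (intro mult_right_mono power_increasing) auto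
      also have "\<dots> = (A * x powr \<rho>) ^ (s * E)" by (simp only: power_mult_distrib powrk \<rho>E)
      also have "\<dots> \<le> real n ^ (s * E)" using n_ge A1 by (intro power_mono) auto
      finally show ?thesis .
    qed
    have M1: "1 \<le> M" using n0 by (simp add: M_def)
    have M_le: "M \<le> U * x powr \<kappa>"
    proof -
      have "M \<le> (2 * A * x powr \<rho>) ^ D" unfolding M_def using n_le by (intro power_mono) auto
      also have "\<dots> = U * x powr \<kappa>" by (simp only: power_mult_distrib powrk U_def \<kappa>_def)
      finally show ?thesis .
    qed
    have lnM: "ln M \<le> ln U + \<kappa> * ln x"
    proof -
      have "ln M \<le> ln (U * x powr \<kappa>)" using M_le M1 by simp
      also have "\<dots> = ln U + \<kappa> * ln x" using U1 x0 by (simp add: ln_mult ln_powr)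
      finally show ?thesis .
    qed
    have lnM0: "0 \<le> ln M" using M1 by simp
    have NM: "2 * x \<le> M"
    proof -
      have "(2 * x) ^ s = 2 ^ s * x ^ s" by (rule power_mult_distrib)
      also have "\<dots> \<le> A * x ^ \<sigma>"
        unfolding A_def using x1 d by (intro mult_mono power_increasing) (auto simp: \<sigma>_def)
      also have "\<dots> \<le> (real n ^ E) ^ s" using nsE by (simp only: power_mult[symmetric] mult.commute)
      finally have "2 * x \<le> real n ^ E" using s by (subst (asm) power_mono_iff) (use x0 in auto)
      also have "\<dots> \<le> M" unfolding M_def DE using n0 by (intro power_increasing) auto
      finally show ?thesis .
    qed
    have few: "M ^ d * (real n ^ (d - 1)) ^ s * (2 * x / M) ^ (d + s) \<le> x / 2"
    proof -
      have Ms: "M ^ s = real n ^ (s * E) * (real n ^ (d - 1)) ^ s"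
        by (simp only: M_def DE power_add power_mult_distrib power_mult[symmetric] mult.commute)
      have nz: "(real n ^ (d - 1)) ^ s \<noteq> 0" "M ^ d \<noteq> 0" using n0 M1 by auto
      have cancel: "a * p * (y / (a * (q * p))) = y / q" if "p \<noteq> 0" "a \<noteq> 0" for a p q y :: real
        using that by simp
      have "M ^ d * (real n ^ (d - 1)) ^ s * (2 * x / M) ^ (d + s) = (2 * x) ^ (d + s) / real n ^ (s * E)"
        unfolding power_divide power_add[of M] Ms by (rule cancel[OF nz])
      also have "\<dots> \<le> (2 * x) ^ (d + s) / (A * x ^ \<sigma>)"
        using nsE x0 A1 by (intro divide_left_mono mult_pos_pos) (auto simp: n0)
      also have "(2 * x) ^ (d + s) = 2 ^ (d + s) * (x * x ^ \<sigma>)"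
      proof -
        have "d + s = Suc \<sigma>" using d by (simp add: \<sigma>_def)
        then show ?thesis by (simp add: power_mult_distrib)
      qed
      also have "2 ^ (d + s) * (x * x ^ \<sigma>) / (A * x ^ \<sigma>) = x / 2"
        using x0 by (simp add: A_def)
      finally show ?thesis .
    qed
    have m1: "real d + 24 \<le> real m" using e1 m_ge by linarith
    have md: "CARD('d) < m" using m1 unfolding d_def by linarith
    have c1: "c * (real h ^ D * M) \<le> C\<^sup>2"
    proof -
      have "x * x powr (2 * \<delta>) = (x powr (1 / 2 + \<delta>))\<^sup>2"
      proof -
        have "(x powr (1 / 2 + \<delta>))\<^sup>2 = x powr (1 + 2 * \<delta>)"
          by (simp add: power2_eq_square flip: powr_add)
        then show ?thesis using x0 by (simp add: powr_add)
      qed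
      also have "\<dots> \<le> (real m)\<^sup>2" using m_ge by (intro power_mono) auto
      finally have m2: "x * x powr (2 * \<delta>) \<le> (real m)\<^sup>2" .
      have "c * (real h ^ D * M) = (c * real h ^ D * 1152) * (M / 1152)" by simp
      also have "\<dots> \<le> x powr (2 * \<delta>) * (M / 1152)" using e3 M1 by (intro mult_right_mono) auto
      also have "\<dots> = (2 * x * M) * (x * x powr (2 * \<delta>)) / (48 * x)\<^sup>2"
        using x0 by (simp add: power2_eq_square)
      also have "\<dots> \<le> (M * M) * (real m)\<^sup>2 / (48 * x)\<^sup>2"
        using NM m2 M1 x0 by (intro divide_right_mono mult_mono mult_right_mono) auto
      also have "\<dots> = C\<^sup>2" by (simp add: C_def x_def power2_eq_square)
      finally show ?thesis .
    qed
    have c2: "real h ^ D * M \<le> real b * C"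
    proof -
      have "x * x powr \<delta> = sqrt x * x powr (1 / 2 + \<delta>)"
        using x0 by (simp add: powr_add powr_half_sqrt flip: mult.assoc)
      also have "\<dots> \<le> real b * real m" using b_ge m_ge by (intro mult_mono) auto
      finally have bm: "x * x powr \<delta> \<le> real b * real m" .
      have "real h ^ D * M = (48 * real h ^ D) * x * (M / (48 * x))" using x0 by simp
      also have "\<dots> \<le> x powr \<delta> * x * (M / (48 * x))"
        using e2 x0 M1 by (intro mult_right_mono) auto
      also have "\<dots> \<le> (real b * real m) * (M / (48 * x))"
        using bm x0 M1 by (intro mult_right_mono) (auto simp: mult.commute)
      also have "\<dots> = real b * C" by (simp add: C_def x_def)
      finally show ?thesis .
    qed
    have c3: "real h ^ D * M \<le> real b ^ (2 * h - 1)"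
    proof -
      have "real h ^ D * M \<le> real h ^ D * (U * x powr \<kappa>)" using M_le by (intro mult_left_mono) auto
      also have "\<dots> \<le> x powr g" using e4 by (simp add: mult.assoc)
      also have "\<dots> = (sqrt x) ^ (2 * h - 1)"
        using x0 powr_realpow[of "sqrt x" "2 * h - 1"] by (simp add: g_def powr_half_sqrt[symmetric] powr_powr)
      also have "\<dots> \<le> real b ^ (2 * h - 1)" using b_ge x0 by (intro power_mono) auto
      finally show ?thesis .
    qed
    have c4: "(1 - \<eta>) ^ R * M \<le> C"
    proof -
      have "ln M / \<eta> \<le> real R" unfolding R_def by linarith
      then have "ln M \<le> \<eta> * real R" using \<eta> by (simp add: pos_divide_le_eq mult.commute)
      have "(1 - \<eta>) ^ R \<le> exp (- \<eta>) ^ R"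
        using \<eta> exp_ge_add_one_self[of "- \<eta>"] by (intro power_mono) auto
      also have "\<dots> = exp (- (\<eta> * real R))" by (simp add: exp_of_nat_mult[symmetric] mult.commute)
      also have "\<dots> \<le> exp (- ln M)" using \<open>ln M \<le> \<eta> * real R\<close> by simp
      also have "\<dots> = 1 / M" using M1 by (simp add: exp_minus divide_inverse)
      finally have "(1 - \<eta>) ^ R * M \<le> 1" using M1 by (simp add: pos_le_divide_eq)
      also have "1 \<le> (2 * x) * real m / (48 * x)" using m1 x0 by simp
      also have "\<dots> \<le> C" unfolding C_def x_def[symmetric] using NM x0
        by (intro divide_right_mono mult_right_mono) auto
      finally show ?thesis .
    qed
    have c5: "M ^ (2 * h * b * R) \<le> 2 ^ m"
    proof -
      define l where "l = ln U + \<kappa> * ln x"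
      have R_le: "real R \<le> l / \<eta> + 1"
      proof -
        have "0 \<le> ln M / \<eta>" using lnM0 \<eta> by simp
        then have "real R \<le> ln M / \<eta> + 1" unfolding R_def by linarith
        also have "\<dots> \<le> l / \<eta> + 1" using lnM \<eta> unfolding l_def by (intro add_right_mono divide_right_mono) auto
        finally show ?thesis .
      qed
      have "real (2 * h * b * R) * ln M = 2 * real h * real b * real R * ln M" by simp
      also have "\<dots> \<le> 2 * real h * (2 * sqrt x) * (l / \<eta> + 1) * l"
        using b_le R_le lnM lnM0 x0 \<eta> unfolding l_def[symmetric]
        by (intro mult_mono) (auto intro!: mult_nonneg_nonneg add_nonneg_nonneg divide_nonneg_pos)
      also have "\<dots> \<le> x powr (1 / 2 + \<delta>) * ln 2" using e5 by (simp add: l_def)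
      also have "\<dots> \<le> real m * ln 2" using m_ge by (intro mult_right_mono) auto
      finally have "exp (real (2 * h * b * R) * ln M) \<le> exp (real m * ln 2)" by simp
      moreover have "exp (real k * ln y) = y ^ k" if "0 < y" for k y
        using that by (simp add: exp_of_nat_mult)
      moreover have "0 < M" "0 < (2 :: real)" using M1 by auto
      ultimately show ?thesis by (simp only:)
    qed
    have "alpha TYPE('d) s N < m"
      by (rule main[rule_format, of M n D C m N b s R])
        (use n0 b0 x1 md NM few c1 c2 c3 c4 c5 in \<open>simp_all add: M_def C_def x_def d_def\<close>)
    then have "int (alpha TYPE('d) s N) < \<lceil>x powr (1 / 2 + \<delta>)\<rceil>" unfolding m_def by linarith
    then have "real (alpha TYPE('d) s N) < x powr (1 / 2 + \<delta>)" by (simp add: less_ceiling_iff)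
    then show ?case by (simp add: x_def)
  qed
qed

lemma alpha_one_le: "0 < s \<Longrightarrow> alpha TYPE('d::finite) s 1 \<le> 1"
proof -
  assume s: "0 < s"
  have "alpha TYPE('d) s 1 < 2"
  proof (rule alpha_less[of "{0}"])
    show "no_members_on_hyperplane (CARD('d) + s) {0 :: real ^ 'd}"
      unfolding no_members_on_hyperplane_def
    proof clarify
      fix T :: "(real ^ 'd) set" and H
      assume T: "T \<subseteq> {0}" "card T = CARD('d) + s"
      have "card T \<le> card {0 :: real ^ 'd}" using T(1) by (intro card_mono) auto
      moreover have "0 < CARD('d)" by simp
      ultimately show False using T(2) s by simp
    qed
    show "card Q < 2" if "Q \<subseteq> {0 :: real ^ 'd}" for Q
      using card_mono[OF _ that] by simp
  qed auto
  then show ?thesis by simp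
qed

text \<open>
  The exponents \<open>ln (a N) / ln N\<close>, raised to $1/2$ where they are smaller, tend to $1/2$ as soon as every
  constant above $1/2$ is eventually an admissible exponent.
\<close>

lemma exponent_tendsto_half:
  fixes a :: "nat \<Rightarrow> nat"
  assumes one: "a 1 \<le> 1"
    and ev: "\<And>\<delta>::real. 0 < \<delta> \<Longrightarrow> eventually (\<lambda>N. real (a N) \<le> real N powr (1 / 2 + \<delta>)) sequentially"
  shows "\<exists>\<epsilon> :: nat \<Rightarrow> real. \<epsilon> \<longlonglongrightarrow> 0 \<and> (\<forall>N\<ge>1. real (a N) \<le> real N powr (1 / 2 + \<epsilon> N))"
proof -
  \<comment> \<open>For \<open>N = 1\<close> and for \<open>a N = 0\<close> the conventions for logarithm and division give the value \<open>0\<close>.\<close>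
  define \<epsilon> where "\<epsilon> = (\<lambda>N. max 0 (ln (real (a N)) / ln (real N) - 1 / 2))"
  have "\<epsilon> \<longlonglongrightarrow> 0"
  proof (rule LIMSEQ_I)
    fix r :: real assume r: "0 < r"
    have "eventually (\<lambda>N. norm (\<epsilon> N - 0) < r) sequentially"
      using ev[OF half_gt_zero[OF r]] eventually_ge_at_top[of 2]
    proof eventually_elim
      case (elim N)
      have lnN: "0 < ln (real N)" using elim by simp
      show ?case
      proof (cases "a N = 0")
        case True
        then show ?thesis using r by (simp add: \<epsilon>_def)
      next
        case False
        have "ln (real (a N)) \<le> ln (real N powr (1 / 2 + r / 2))"
          using elim False by (subst ln_le_cancel_iff) auto
        also have "\<dots> = (1 / 2 + r / 2) * ln (real N)" using elim by (simp add: ln_powr)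
        finally have "ln (real (a N)) / ln (real N) \<le> 1 / 2 + r / 2" using lnN by (simp add: pos_divide_le_eq)
        then show ?thesis using r by (simp add: \<epsilon>_def)
      qed
    qed
    then show "\<exists>no. \<forall>n\<ge>no. norm (\<epsilon> n - 0) < r" by (simp add: eventually_sequentially)
  qed
  moreover have "real (a N) \<le> real N powr (1 / 2 + \<epsilon> N)" if N: "N \<ge> 1" for N
  proof (cases "N = 1 \<or> a N = 0")
    case True
    then show ?thesis using one by auto
  next
    case False
    then have N2: "2 \<le> N" using N by simp
    then have lnN: "0 < ln (real N)" by simp
    have "real (a N) = exp (ln (real (a N)) / ln (real N) * ln (real N))" using False lnN by simp
    also have "\<dots> = real N powr (ln (real (a N)) / ln (real N))" using N2 by (simp add: powr_def)
    also have "\<dots> \<le> real N powr (1 / 2 + \<epsilon> N)" using N2 by (intro powr_mono) (auto simp: \<epsilon>_def)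
    finally show ?thesis .
  qed
  ultimately show ?thesis by blast
qed

theorem theorem1p2:
  fixes d s :: nat
  assumes "CARD('d::finite) = d" and "d \<ge> 3" and "s \<ge> 3"
  shows "(odd d \<and> d * s + 2 > 2 * d + 2 * s \<longrightarrow>
           (\<exists>\<epsilon> :: nat \<Rightarrow> real. \<epsilon> \<longlonglongrightarrow> 0 \<and>
             (\<forall>N\<ge>1. real (alpha TYPE('d) s N) \<le> real N powr (1 / 2 + \<epsilon> N)))) \<and>
         (even d \<and> d * s + 2 > 2 * d + 3 * s \<longrightarrow>
           (\<exists>\<epsilon> :: nat \<Rightarrow> real. \<epsilon> \<longlonglongrightarrow> 0 \<and>
             (\<forall>N\<ge>1. real (alpha TYPE('d) s N) \<le> real N powr (1 / 2 + \<epsilon> N))))"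
proof -
  have bound: "\<exists>\<epsilon> :: nat \<Rightarrow> real. \<epsilon> \<longlonglongrightarrow> 0 \<and>
      (\<forall>N\<ge>1. real (alpha TYPE('d) s N) \<le> real N powr (1 / 2 + \<epsilon> N))"
    if "2 \<le> h" "2 * h \<le> d + 1" "2 * (d + s - 1) < s * (2 * h - 1)" for h
  proof (rule exponent_tendsto_half)
    show "alpha TYPE('d) s 1 \<le> 1" by (rule alpha_one_le) (use assms in simp)
    show "eventually (\<lambda>N. real (alpha TYPE('d) s N) \<le> real N powr (1 / 2 + \<delta>)) sequentially"
      if "0 < \<delta>" for \<delta> :: real
      by (rule alpha_eventually_le[of h]) (use assms \<open>2 \<le> h\<close> \<open>2 * h \<le> d + 1\<close> \<open>2 * (d + s - 1) < s * (2 * h - 1)\<close> that in simp_all)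
  qed
  show ?thesis
  proof (intro conjI impI)
    assume A: "odd d \<and> d * s + 2 > 2 * d + 2 * s"
    then obtain k where k: "d = 2 * k + 1" by (elim conjE oddE)
    show "\<exists>\<epsilon> :: nat \<Rightarrow> real. \<epsilon> \<longlonglongrightarrow> 0 \<and>
      (\<forall>N\<ge>1. real (alpha TYPE('d) s N) \<le> real N powr (1 / 2 + \<epsilon> N))"
    proof (rule bound[of "k + 1"])
      have "2 * (k + 1) - 1 = d" using k by simp
      then have "s * (2 * (k + 1) - 1) = d * s" by (simp only: mult.commute)
      then show "2 * (d + s - 1) < s * (2 * (k + 1) - 1)" using A assms by linarith
    qed (use k assms in auto)
  next
    assume A: "even d \<and> d * s + 2 > 2 * d + 3 * s"
    then obtain k where k: "d = 2 * k" by (elim conjE evenE)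
    show "\<exists>\<epsilon> :: nat \<Rightarrow> real. \<epsilon> \<longlonglongrightarrow> 0 \<and>
      (\<forall>N\<ge>1. real (alpha TYPE('d) s N) \<le> real N powr (1 / 2 + \<epsilon> N))"
    proof (rule bound[of k])
      have "s * (2 * k - 1) = d * s - s" using k by (simp add: diff_mult_distrib2 mult.commute)
      then show "2 * (d + s - 1) < s * (2 * k - 1)" using A assms by linarith
    qed (use k assms in auto)
  qed
qed

end
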